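(* Let $B$ be a unital commutative semiprime complex Banach algebra with connected character space $\Phi_B$, let $T$ be a bounded unital endomorphism of $B$, and let $\phi$ be the associated selfmap of $\Phi_B$. Then $T$ is quasicompact if and only if the operators $T^n$ converge in operator norm (as $n\to\infty$) to a rank-one unital endomorphism of $B$. In this case $\phi$ has a unique fixed point $x_0\in\Phi_B$, and the rank-one endomorphism above must be the endomorphism $b\mapsto \hat b(x_0)\,1$.
   Context: All algebras are complex. A complex algebra $B$ is semiprime if $J=\{0\}$ is the only ideal of $B$ such that the product of every pair of elements of $J$ is $0$; a commutative complex algebra is semiprime if and only if it has no non-zero nilpotent elements. $\Phi_B$ denotes the character space of $B$ (with the Gelfand topology), and $\hat b$ the Gelfand transform of $b\in B$. An endomorphism of a commutative Banach algebra is a linear map of the algebra to itself preserving multiplication; it is unital if it maps the identity to itself. For a unital endomorphism $T$ of $B$, the associated selfmap $\phi:\Phi_B\to\Phi_B$ is $\phi=T^*|_{\Phi_B}$, i.e. $\phi(x)=x\circ T$, so that $\widehat{Tb}=\hat b\circ\phi$ for all $b\in B$. A bounded linear operator $T$ on an infinite-dimensional Banach space $E$ is quasicompact if its essential spectral radius $\rho_e(T)$, i.e. the spectral radius of $T+\mathcal{K}(E)$ in the Calkin algebra $\mathcal{L}(E)/\mathcal{K}(E)$, satisfies $\rho_e(T)<1$. Here $\mathcal{L}(E)$ is the algebra of bounded linear operators on $E$ and $\mathcal{K}(E)$ is the ideal of compact operators. Equivalently, there is a natural number $n\ge 1$ such that the operator-norm distance from $T^n$ to $\mathcal{K}(E)$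 is strictly less than $1$. If $E$ is finite-dimensional, every operator on $E$ is regarded as quasicompact (the distance condition holds trivially). *)

theory Defs
  imports "HOL-Analysis.Analysis"
begin

text \<open>The complex scalar multiplication extends the library's real one. In the algebra class the
  unit satisfies \<open>1 \<noteq> 0\<close>, but the normalisation \<open>norm 1 = 1\<close> is not assumed.\<close>

class scaleC =
  fixes scaleC :: "complex \<Rightarrow> 'a \<Rightarrow> 'a"  (infixr "*\<^sub>C" 75)

class complex_banach_space = banach + scaleC +
  assumes scaleC_add_right: "a *\<^sub>C (x + y) = a *\<^sub>C x + a *\<^sub>C y"
    and scaleC_add_left: "(a + b) *\<^sub>C x = a *\<^sub>C x + b *\<^sub>C x"
    and scaleC_scaleC: "a *\<^sub>C b *\<^sub>C x = (a * b) *\<^sub>C x"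
    and scaleC_of_real: "complex_of_real r *\<^sub>C x = r *\<^sub>R x"
    and norm_scaleC: "norm (a *\<^sub>C x) = cmod a * norm x"

class comm_complex_banach_algebra_1 = complex_banach_space + comm_ring_1 + real_normed_algebra +
  assumes scaleC_mult_left: "a *\<^sub>C x * y = a *\<^sub>C (x * y)"

global_interpretation complex_vector:
  vector_space "scaleC :: complex \<Rightarrow> 'a \<Rightarrow> 'a::complex_banach_space"
proof
  show "1 *\<^sub>C x = x" for x :: 'a
    using scaleC_of_real[of 1 x] by simp
qed (simp_all add: scaleC_add_right scaleC_add_left scaleC_scaleC)

instantiation complex :: comm_complex_banach_algebra_1
begin

definition scaleC_complex :: "complex \<Rightarrow> complex \<Rightarrow> complex" where
  "scaleC_complex a x = a * x"

instance
  by standard (simp_all add: scaleC_complex_def algebra_simps scaleR_conv_of_real norm_mult)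

end

abbreviation clinear :: "('a::complex_banach_space \<Rightarrow> 'b::complex_banach_space) \<Rightarrow> bool" where
  "clinear \<equiv> Vector_Spaces.linear scaleC scaleC"


subsection \<open>Bounded, compact and quasicompact operators\<close>

definition bounded_clinear :: "('a::complex_banach_space \<Rightarrow> 'b::complex_banach_space) \<Rightarrow> bool" where
  "bounded_clinear f \<longleftrightarrow> clinear f \<and> bounded_linear f"

definition compact_operator ::
    "('a::complex_banach_space \<Rightarrow> 'b::complex_banach_space) \<Rightarrow> bool" where
  "compact_operator K \<longleftrightarrow> bounded_clinear K \<and> compact (closure (K ` cball 0 1))"

text \<open>Invertibility of the coset of \<open>T\<close> in the Calkin algebra, written out on representatives.\<close>

definition calkin_invertible :: "('a::complex_banach_space \<Rightarrow> 'a) \<Rightarrow> bool" where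
  "calkin_invertible T \<longleftrightarrow> (\<exists>S. bounded_clinear S \<and>
     compact_operator (\<lambda>x. S (T x) - x) \<and> compact_operator (\<lambda>x. T (S x) - x))"

definition essential_spectrum :: "('a::complex_banach_space \<Rightarrow> 'a) \<Rightarrow> complex set" where
  "essential_spectrum T = {c. \<not> calkin_invertible (\<lambda>x. T x - c *\<^sub>C x)}"

text \<open>The supremum is taken in \<^typ>\<open>ennreal\<close> so that no side conditions are needed for it to exist.
  For bounded \<open>T\<close> on an infinite-dimensional space the essential spectrum is non-empty and
  bounded, so this is the usual (finite) essential spectral radius.\<close>

definition essential_spectral_radius :: "('a::complex_banach_space \<Rightarrow> 'a) \<Rightarrow> ennreal" where
  "essential_spectral_radius T = (SUP c\<in>essential_spectrum T. ennreal (cmod c))"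

definition quasicompact :: "('a::complex_banach_space \<Rightarrow> 'a) \<Rightarrow> bool" where
  "quasicompact T \<longleftrightarrow> bounded_clinear T \<and>
     ((\<exists>S::'a set. finite S \<and> complex_vector.span S = UNIV) \<or> essential_spectral_radius T < 1)"

text \<open>Boundedness of the operators is part of the notion because \<^const>\<open>onorm\<close> is only meaningful for
  bounded operators.\<close>

definition converges_in_operator_norm ::
    "(nat \<Rightarrow> 'a::complex_banach_space \<Rightarrow> 'b::complex_banach_space) \<Rightarrow> ('a \<Rightarrow> 'b) \<Rightarrow> bool" where
  "converges_in_operator_norm F P \<longleftrightarrow> (\<forall>n. bounded_clinear (F n)) \<and> bounded_clinear P \<and>
     (\<lambda>n. onorm (\<lambda>x. F n x - P x)) \<longlonglongrightarrow> 0"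

definition rank_one :: "('a::complex_banach_space \<Rightarrow> 'b::complex_banach_space) \<Rightarrow> bool" where
  "rank_one P \<longleftrightarrow> complex_vector.dim (range P) = 1"


subsection \<open>Ideals, characters and endomorphisms\<close>

definition algebra_ideal :: "'a::comm_complex_banach_algebra_1 set \<Rightarrow> bool" where
  "algebra_ideal J \<longleftrightarrow> complex_vector.subspace J \<and> (\<forall>b. \<forall>x\<in>J. b * x \<in> J)"

definition semiprime :: "'a::comm_complex_banach_algebra_1 itself \<Rightarrow> bool" where
  "semiprime (_ :: 'a itself) \<longleftrightarrow>
     (\<forall>J::'a set. algebra_ideal J \<and> (\<forall>x\<in>J. \<forall>y\<in>J. x * y = 0) \<longrightarrow> J = {0})"

definition character_space :: "('a::comm_complex_banach_algebra_1 \<Rightarrow> complex) set" where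
  "character_space = {x. clinear x \<and> (\<forall>a b. x (a * b) = x a * x b) \<and> (\<exists>b. x b \<noteq> 0)}"

text \<open>The Gelfand topology is the topology of pointwise convergence on the character space.\<close>

definition gelfand_topology :: "('a::comm_complex_banach_algebra_1 \<Rightarrow> complex) topology" where
  "gelfand_topology = subtopology (product_topology (\<lambda>_. euclidean) UNIV) character_space"

definition gelfand_transform ::
    "'a::comm_complex_banach_algebra_1 \<Rightarrow> ('a \<Rightarrow> complex) \<Rightarrow> complex" where
  "gelfand_transform b x = x b"

definition unital_endomorphism :: "('a::comm_complex_banach_algebra_1 \<Rightarrow> 'a) \<Rightarrow> bool" where
  "unital_endomorphism T \<longleftrightarrow> clinear T \<and> (\<forall>a b. T (a * b) = T a * T b) \<and> T 1 = 1"

definition associated_selfmap ::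
    "('a::comm_complex_banach_algebra_1 \<Rightarrow> 'a) \<Rightarrow> ('a \<Rightarrow> complex) \<Rightarrow> ('a \<Rightarrow> complex)" where
  "associated_selfmap T x = x \<circ> T"

lemma associated_selfmap_in_character_space:
  assumes "unital_endomorphism T" and "x \<in> character_space"
  shows "associated_selfmap T x \<in> character_space"
proof -
  obtain b where "x b \<noteq> 0"
    using assms(2) by (auto simp: character_space_def)
  moreover have "x b = x b * x 1"
    using assms(2) by (metis (mono_tags, lifting) character_space_def mem_Collect_eq mult.right_neutral)
  ultimately have "x (T 1) \<noteq> 0"
    using assms(1) by (auto simp: unital_endomorphism_def)
  moreover have "clinear (x \<circ> T)"
    using assms by (auto simp: unital_endomorphism_def character_space_def intro: Vector_Spaces.linear_compose)
  ultimately show ?thesis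
    using assms by (auto intro!: exI[of _ 1] simp: associated_selfmap_def unital_endomorphism_def character_space_def)
qed

lemma gelfand_transform_endomorphism:
  "gelfand_transform (T b) x = gelfand_transform b (associated_selfmap T x)"
  by (simp add: gelfand_transform_def associated_selfmap_def)

end

theory Submission
  imports Defs "HOL-Computational_Algebra.Fundamental_Theorem_Algebra"
begin

text \<open>
  Suppose that \<open>T\<close> is quasicompact. Then \<open>T - c\<close> is a Fredholm operator for \<open>|c| \<ge> 1\<close>, and the point is to
  show that multiplicativity leaves \<open>1\<close> as its only eigenvalue there, with the scalars as generalized
  eigenspace. The fixed points of \<open>T\<close> form a finite-dimensional algebra. Its elements are algebraic,
  and over a connected character space an algebraic element of a semiprime algebra is a scalar
  (\<open>algebraic_element_scalar\<close>). A generalized eigenvector \<open>T f = f + c\<close> with \<open>c \<noteq> 0\<close> is impossible, because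
  a character \<open>h\<close> would give \<open>h (T\<^sup>n f) = h f + n c\<close>, which must be bounded by \<open>\<parallel>f\<parallel>\<close>. If \<open>T f = c f\<close>
  with \<open>f \<noteq> 0\<close>, then \<open>T (f\<^sup>n) = c\<^sup>n f\<^sup>n\<close> with \<open>f\<^sup>n \<noteq> 0\<close>. So \<open>|c| > 1\<close> contradicts boundedness, and for \<open>|c| = 1\<close>
  some power \<open>c\<^sup>n\<close> is as close to \<open>1\<close> as desired. Eigenvalues cannot accumulate at \<open>1\<close>, so \<open>c\<^sup>n = 1\<close>, hence
  \<open>f\<^sup>n\<close> is a scalar, \<open>f\<close> is algebraic, and \<open>f\<close> is a scalar (\<open>peripheral_eigenvalue\<close>).

  Now take any character \<open>h\<close> and put \<open>D = T - h\<cdot>1\<close>. This operator has no eigenvalues of modulus at least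
  \<open>1\<close>, and \<open>1 - z D\<close> is still Fredholm for \<open>|z| \<le> 1\<close>. By compactness of the disc these operators are
  uniformly bounded below, and invertibility spreads from \<open>z = 0\<close> over the disc. So \<open>D\<close> has spectral
  radius less than \<open>1\<close> and \<open>D\<^sup>n \<rightarrow> 0\<close> in norm. This last implication is proved by averaging resolvents
  over roots of unity, as in Rickart's elementary proof of the spectral radius formula
  (\<open>powers_tend_to_zero\<close>). Finally \<open>T\<^sup>n = D\<^sup>n + h(1 + D + \<dots> + D\<^sup>n\<^sup>-\<^sup>1)\<cdot>1\<close> converges to the
  operator \<open>h((1 - D)\<^sup>-\<^sup>1)\<cdot>1\<close> of rank one, which inherits multiplicativity from the powers of \<open>T\<close>
  and is therefore of the form \<open>b \<mapsto> x\<^sub>0(b) 1\<close> with a character \<open>x\<^sub>0\<close> fixed by \<open>\<phi>\<close>. A character fixed by \<open>\<phi>\<close>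
  is invariant under this limit and so equals \<open>x\<^sub>0\<close>.

  Characters come from algebra seminorms below the norm. By Zorn's lemma there are minimal ones. Minimality makes
  a seminorm multiplicative, and Ostrowski's form of the Gelfand--Mazur argument turns a multiplicative seminorm
  into the absolute value of a character. Applied to the operator norm on an annihilator this yields a
  character that vanishes at a given zero divisor (\<open>zero_divisor_character\<close>). It is what identifies the
  roots of a minimal polynomial with character values.

  Conversely, if \<open>T\<^sup>n\<close> converges to \<open>P\<close> of rank one, then \<open>\<parallel>T\<^sup>m - P\<parallel> \<le> 1/2\<close> for some \<open>m\<close>. If \<open>|c|\<^sup>m > 1/2\<close>,
  then \<open>T\<^sup>m - c\<^sup>m\<close> is invertible modulo \<open>P\<close>, and so is its factor \<open>T - c\<close>
  (\<open>calkin_invertible_if_power_near_rank_one\<close>). Thus the essential spectral radius is at most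
  \<open>(1/2)\<^sup>1\<^sup>/\<^sup>m < 1\<close>.
\<close>

section \<open>Bounded complex-linear operators\<close>

lemmas scaleC_one = complex_vector.scale_one
lemmas scaleC_diff_right = complex_vector.scale_right_diff_distrib
lemmas scaleC_diff_left = complex_vector.scale_left_diff_distrib
lemmas scaleC_minus_left = complex_vector.scale_minus_left
lemmas scaleC_sum_right = complex_vector.scale_sum_right
lemmas scaleC_sum_left = complex_vector.scale_sum_left

lemma scaleC_mult_right:
  fixes x y :: "'a::comm_complex_banach_algebra_1"
  shows "x * a *\<^sub>C y = a *\<^sub>C (x * y)"
  by (metis mult.commute scaleC_mult_left)

lemma scaleC_one_inject:
  "c *\<^sub>C (1::'a::comm_complex_banach_algebra_1) = d *\<^sub>C 1 \<longleftrightarrow> c = d"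
proof
  assume "c *\<^sub>C (1::'a) = d *\<^sub>C 1"
  then have "norm ((c - d) *\<^sub>C (1::'a)) = 0" by (simp add: scaleC_diff_left)
  then show "c = d" by (simp add: norm_scaleC)
qed simp

lemma clinear_iff:
  "clinear f \<longleftrightarrow> (\<forall>x y. f (x + y) = f x + f y) \<and> (\<forall>c x. f (c *\<^sub>C x) = c *\<^sub>C f x)"
  by (simp add: Vector_Spaces.linear_iff complex_vector.vector_space_axioms)

lemma bounded_clinearI:
  fixes f :: "'a::complex_banach_space \<Rightarrow> 'b::complex_banach_space"
  assumes "\<And>x y. f (x + y) = f x + f y" "\<And>c x. f (c *\<^sub>C x) = c *\<^sub>C f x"
    and "\<And>x. norm (f x) \<le> K * norm x"
  shows "bounded_clinear f"
proof -
  have "f (r *\<^sub>R x) = r *\<^sub>R f x" for r x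
    using assms(2)[of "complex_of_real r" x] by (simp add: scaleC_of_real)
  then have "bounded_linear f"
    using assms by (intro bounded_linear_intro[of f K]) (auto simp: mult.commute)
  then show ?thesis
    using assms by (simp add: bounded_clinear_def clinear_iff)
qed

lemma bounded_clinear_add: "bounded_clinear f \<Longrightarrow> f (x + y) = f x + f y"
  by (simp add: bounded_clinear_def clinear_iff)

lemma bounded_clinear_scaleC: "bounded_clinear f \<Longrightarrow> f (c *\<^sub>C x) = c *\<^sub>C f x"
  by (simp add: bounded_clinear_def clinear_iff)

lemma bounded_clinear_linear: "bounded_clinear f \<Longrightarrow> bounded_linear f"
  by (simp add: bounded_clinear_def)

lemma bounded_clinear_diff: "bounded_clinear f \<Longrightarrow> f (x - y) = f x - f y"
  by (simp add: bounded_clinear_linear bounded_linear.linear linear_diff)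

lemma bounded_clinear_minus: "bounded_clinear f \<Longrightarrow> f (- x) = - f x"
  by (simp add: bounded_clinear_linear bounded_linear.linear linear_neg)

lemma bounded_clinear_zero: "bounded_clinear f \<Longrightarrow> f 0 = 0"
  by (simp add: bounded_clinear_linear bounded_linear.linear linear_0)

lemma bounded_clinear_sum: "bounded_clinear f \<Longrightarrow> f (\<Sum>i\<in>I. g i) = (\<Sum>i\<in>I. f (g i))"
  by (simp add: bounded_clinear_linear bounded_linear.linear linear_sum)

lemma bounded_clinear_bound:
  assumes "bounded_clinear f"
  obtains K where "K > 0" "\<And>x. norm (f x) \<le> K * norm x"
  using bounded_linear.pos_bounded[OF bounded_clinear_linear[OF assms]] by (metis mult.commute)

lemma bounded_clinear_tendsto:
  "bounded_clinear f \<Longrightarrow> (g \<longlongrightarrow> l) F \<Longrightarrow> ((\<lambda>n. f (g n)) \<longlongrightarrow> f l) F"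
  by (rule bounded_linear.tendsto[OF bounded_clinear_linear])

lemmas bounded_clinear_simps =
  bounded_clinear_add bounded_clinear_scaleC bounded_clinear_diff bounded_clinear_minus
  bounded_clinear_zero bounded_clinear_sum

lemma bounded_clinear_ident: "bounded_clinear (\<lambda>x. x)"
  by (rule bounded_clinearI[of _ 1]) auto

lemma bounded_clinear_compose:
  assumes f: "bounded_clinear f" and g: "bounded_clinear g"
  shows "bounded_clinear (\<lambda>x. f (g x))"
  using assms bounded_linear_compose[of f g]
  by (simp add: bounded_clinear_def clinear_iff)

lemma bounded_clinear_of_scaleC:
  assumes f: "bounded_clinear f"
  shows "bounded_clinear (\<lambda>x. c *\<^sub>C f x)"
proof -
  obtain K where K: "\<And>x. norm (f x) \<le> K * norm x"
    using bounded_clinear_bound[OF f] by blast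
  show ?thesis
  proof (rule bounded_clinearI[of _ "cmod c * K"])
    show "norm (c *\<^sub>C f x) \<le> cmod c * K * norm x" for x
      using mult_left_mono[OF K[of x], of "cmod c"] by (simp add: norm_scaleC mult.assoc)
  qed (auto simp: bounded_clinear_simps[OF f] scaleC_add_right mult.commute)
qed

lemma bounded_clinear_plus:
  assumes f: "bounded_clinear f" and g: "bounded_clinear g"
  shows "bounded_clinear (\<lambda>x. f x + g x)"
  using assms bounded_linear_add[of f g]
  by (simp add: bounded_clinear_def clinear_iff scaleC_add_right)

lemma bounded_clinear_minus_op:
  assumes f: "bounded_clinear f" and g: "bounded_clinear g"
  shows "bounded_clinear (\<lambda>x. f x - g x)"
  using assms bounded_linear_sub[of f g]
  by (simp add: bounded_clinear_def clinear_iff scaleC_diff_right)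

lemma bounded_clinear_zero_op: "bounded_clinear (\<lambda>x. 0)"
  by (rule bounded_clinearI[of _ 0]) auto

lemma bounded_clinear_sum_op:
  assumes "\<And>i. i \<in> I \<Longrightarrow> bounded_clinear (f i)"
  shows "bounded_clinear (\<lambda>x. \<Sum>i\<in>I. f i x)"
  using assms
  by (induction I rule: infinite_finite_induct)
     (auto intro: bounded_clinear_zero_op bounded_clinear_plus)

lemma bounded_clinear_funpow:
  fixes f :: "'a::complex_banach_space \<Rightarrow> 'a"
  assumes f: "bounded_clinear f"
  shows "bounded_clinear (f ^^ n)"
proof (induction n)
  case 0
  have "f ^^ 0 = (\<lambda>x. x)" by (simp add: fun_eq_iff)
  then show ?case using bounded_clinear_ident by metis
next
  case (Suc n)
  then show ?case using bounded_clinear_compose[OF f Suc] by (simp add: comp_def)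
qed

lemma bounded_clinear_functional_scaleC:
  assumes h: "bounded_clinear (h :: 'a::complex_banach_space \<Rightarrow> complex)"
  shows "bounded_clinear (\<lambda>x. h x *\<^sub>C v)"
proof -
  obtain K where K: "\<And>x. norm (h x) \<le> K * norm x"
    using bounded_clinear_bound[OF h] by blast
  show ?thesis
  proof (rule bounded_clinearI[of _ "K * norm v"])
    show "norm (h x *\<^sub>C v) \<le> K * norm v * norm x" for x
      using mult_right_mono[OF K[of x], of "norm v"] by (simp add: norm_scaleC mult_ac)
  qed (auto simp: bounded_clinear_simps[OF h] scaleC_add_left scaleC_complex_def)
qed

text \<open>The equation \<open>A x + E x = y\<close> is the fixed point equation of \<open>x \<mapsto> A\<^sup>-\<^sup>1 (y - E x)\<close>, which is a contraction
  with constant \<open>q/d\<close>.\<close>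

lemma bounded_below_surj_perturb:
  assumes A: "bounded_clinear A" and E: "bounded_clinear E"
    and below: "\<And>x. d * norm x \<le> norm (A x)" and surj: "surj A"
    and small: "\<And>x. norm (E x) \<le> q * norm x" and "0 \<le> q" "q < d"
  shows "surj (\<lambda>x. A x + E x)"
proof -
  have "\<exists>x. A x + E x = y" for y
  proof -
    define S where "S = inv A"
    have AS: "A (S x) = x" for x
      using surj by (simp add: S_def surj_f_inv_f)
    have "dist (S (y - E u)) (S (y - E v)) \<le> q / d * dist u v" for u v
    proof -
      have "d * norm (S (y - E u) - S (y - E v)) \<le> norm (E (v - u))"
        using below[of "S (y - E u) - S (y - E v)"]
        by (simp add: bounded_clinear_diff[OF A] AS bounded_clinear_diff[OF E])
      also have "\<dots> \<le> q * norm (v - u)" by (rule small)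
      finally show ?thesis
        using assms by (simp add: dist_norm field_simps norm_minus_commute)
    qed
    then have "\<exists>!x. S (y - E x) = x"
      using assms by (intro banach_fix_type[of "q / d"]) auto
    then obtain x where "S (y - E x) = x" by blast
    then have "A x = y - E x" using AS[of "y - E x"] by simp
    then show ?thesis by (auto simp: algebra_simps)
  qed
  then show ?thesis by (metis surjI)
qed

lemma bounded_clinear_inv:
  assumes A: "bounded_clinear A" and d: "d > 0"
    and below: "\<And>x. d * norm x \<le> norm (A x)" and surj: "surj A"
  shows "bounded_clinear (inv A)" "A (inv A x) = x" "inv A (A x) = x"
    "norm (inv A x) \<le> norm x / d"
proof -
  have "inj A"
  proof (rule injI)
    fix x y assume "A x = A y"
    then show "x = y" using below[of "x - y"] d
      by (simp add: bounded_clinear_diff[OF A] mult_le_0_iff)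
  qed
  then have l: "inv A (A x) = x" and r: "A (inv A x) = x" for x
    using surj by (simp_all add: surj_f_inv_f)
  have n: "norm (inv A x) \<le> norm x / d" for x
    using below[of "inv A x"] d by (simp add: r field_simps)
  show "bounded_clinear (inv A)"
  proof (rule bounded_clinearI[of _ "1 / d"])
    show "inv A (x + y) = inv A x + inv A y" for x y
      by (metis l r bounded_clinear_add[OF A])
    show "inv A (c *\<^sub>C x) = c *\<^sub>C inv A x" for c x
      by (metis l r bounded_clinear_scaleC[OF A])
    show "norm (inv A x) \<le> 1 / d * norm x" for x
      using n[of x] by simp
  qed
  show "A (inv A x) = x" "inv A (A x) = x" "norm (inv A x) \<le> norm x / d"
    by (fact r l n)+
qed


section \<open>Finite-dimensional subspaces\<close>

text \<open>The Heine--Borel property of a subspace, in a form that applies to bounded sequences and that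
  includes closedness.\<close>

definition locally_sequentially_compact :: "'a::real_normed_vector set \<Rightarrow> bool" where
  "locally_sequentially_compact W \<longleftrightarrow>
     (\<forall>x. (\<forall>n::nat. x n \<in> W) \<and> bounded (range x) \<longrightarrow>
       (\<exists>l\<in>W. \<exists>r::nat \<Rightarrow> nat. strict_mono r \<and> (x \<circ> r) \<longlonglongrightarrow> l))"

lemma locally_sequentially_compactD:
  assumes "locally_sequentially_compact W" "\<And>n::nat. x n \<in> W" "bounded (range x)"
  obtains l r where "l \<in> W" "strict_mono r" "(x \<circ> r) \<longlonglongrightarrow> l"
  using assms(1)[unfolded locally_sequentially_compact_def, rule_format, of x] assms(2,3) that by auto

lemma closed_if_locally_sequentially_compact:
  assumes "locally_sequentially_compact W"
  shows "closed W"
  unfolding closed_sequential_limits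
proof (intro allI impI)
  fix x l assume x: "(\<forall>n. x n \<in> W) \<and> x \<longlonglongrightarrow> l"
  then have "bounded (range x)" using convergent_imp_bounded by blast
  then obtain l' r where "l' \<in> W" "strict_mono r" "(x \<circ> r) \<longlonglongrightarrow> l'"
    using locally_sequentially_compactD[OF assms, of x] x by auto
  then show "l \<in> W"
    using LIMSEQ_unique LIMSEQ_subseq_LIMSEQ x by blast
qed

lemma infdist_scaleC_le:
  fixes v :: "'a::complex_banach_space"
  assumes W: "complex_vector.subspace W" and w: "w \<in> W"
  shows "cmod t * infdist v W \<le> norm (w + t *\<^sub>C v)"
proof (cases "t = 0")
  case False
  have "- (inverse t *\<^sub>C w) \<in> W"
    using W w by (simp add: complex_vector.subspace_neg complex_vector.subspace_scale)
  then have "infdist v W \<le> dist v (- (inverse t *\<^sub>C w))" by (rule infdist_le)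
  also have "\<dots> = norm (inverse t *\<^sub>C (w + t *\<^sub>C v))"
    using False by (simp add: dist_norm scaleC_add_right add.commute)
  also have "\<dots> = norm (w + t *\<^sub>C v) / cmod t"
    by (simp add: norm_scaleC norm_inverse divide_inverse mult.commute)
  finally show ?thesis using False by (simp add: field_simps)
qed auto

text \<open>Induction on the spanning set: if \<open>v\<close> lies outside the closed span \<open>W\<close> of the other vectors, its
  distance to \<open>W\<close> bounds the coefficient \<open>t\<close> in \<open>w + t v\<close>, so a bounded sequence has bounded
  components along \<open>v\<close> and in \<open>W\<close>.\<close>

lemma locally_sequentially_compact_span:
  fixes Y :: "'a::complex_banach_space set"
  assumes "finite Y"
  shows "locally_sequentially_compact (complex_vector.span Y)"
  using assms
proof (induction Y)
  case empty
  show ?case unfolding locally_sequentially_compact_def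
  proof (intro allI impI)
    fix x :: "nat \<Rightarrow> 'a" assume "(\<forall>n. x n \<in> complex_vector.span {}) \<and> bounded (range x)"
    then have "x = (\<lambda>_. 0)" by (simp add: fun_eq_iff)
    then show "\<exists>l\<in>complex_vector.span {}. \<exists>r. strict_mono r \<and> (x \<circ> r) \<longlonglongrightarrow> l"
      by (auto intro!: exI[of _ id] simp: strict_mono_def comp_def)
  qed
next
  case (insert v Y)
  let ?W = "complex_vector.span Y"
  show ?case
  proof (cases "v \<in> ?W")
    case True
    then show ?thesis using insert.IH by (simp add: complex_vector.span_redundant)
  next
    case v: False
    have "closed ?W" using insert.IH by (rule closed_if_locally_sequentially_compact)
    then have pos: "infdist v ?W > 0"
      using v complex_vector.span_zero[of Y] by (intro infdist_pos_not_in_closed) auto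
    show ?thesis unfolding locally_sequentially_compact_def
    proof (intro allI impI)
      fix x :: "nat \<Rightarrow> 'a" assume x: "(\<forall>n. x n \<in> complex_vector.span (insert v Y)) \<and> bounded (range x)"
      then have "\<forall>n. \<exists>t. x n - t *\<^sub>C v \<in> ?W"
        by (simp add: complex_vector.span_insert)
      then obtain t where t: "\<And>n. x n - t n *\<^sub>C v \<in> ?W" by metis
      obtain B where B: "\<And>n. norm (x n) \<le> B"
        using x by (auto simp: bounded_iff)
      have tb: "cmod (t n) \<le> B / infdist v ?W" for n
        using infdist_scaleC_le[OF complex_vector.subspace_span t[of n], of "t n" v] B[of n] pos
        by (simp add: field_simps)
      then have "bounded (range t)" by (auto simp: bounded_iff)
      then obtain s :: "nat \<Rightarrow> nat" and l where s: "strict_mono s" and l: "(t \<circ> s) \<longlonglongrightarrow> l"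
        using bounded_imp_convergent_subsequence by blast
      let ?w = "\<lambda>n. x (s n) - t (s n) *\<^sub>C v"
      have "norm (?w n) \<le> B + B / infdist v ?W * norm v" for n
        using norm_triangle_ineq4[of "x (s n)" "t (s n) *\<^sub>C v"] B[of "s n"]
          mult_right_mono[OF tb[of "s n"], of "norm v"]
        by (simp add: norm_scaleC)
      then have "bounded (range ?w)" by (auto simp: bounded_iff)
      then obtain m r where m: "m \<in> ?W" and r: "strict_mono r" "(?w \<circ> r) \<longlonglongrightarrow> m"
        using locally_sequentially_compactD[OF insert.IH, of ?w] t by auto
      have "(\<lambda>n. t (s (r n))) \<longlonglongrightarrow> l"
        using LIMSEQ_subseq_LIMSEQ[OF l r(1)] by (simp add: comp_def)
      moreover have "bounded_clinear (\<lambda>a. a *\<^sub>C v)"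
        by (rule bounded_clinearI[of _ "norm v"])
           (auto simp: scaleC_add_left norm_scaleC mult.commute scaleC_complex_def)
      ultimately have "(\<lambda>n. t (s (r n)) *\<^sub>C v) \<longlonglongrightarrow> l *\<^sub>C v"
        using bounded_clinear_tendsto by blast
      from tendsto_add[OF r(2) this] have "(x \<circ> (s \<circ> r)) \<longlonglongrightarrow> m + l *\<^sub>C v"
        by (simp add: comp_def)
      moreover have "m + l *\<^sub>C v \<in> complex_vector.span (insert v Y)"
        using m by (auto simp: complex_vector.span_insert intro!: exI[of _ l])
      ultimately show "\<exists>l\<in>complex_vector.span (insert v Y). \<exists>r. strict_mono r \<and> (x \<circ> r) \<longlonglongrightarrow> l"
        using strict_mono_o[OF s r(1)] by blast
    qed
  qed
qed

lemma Riesz_lemma: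
  fixes v :: "'a::complex_banach_space"
  assumes W: "complex_vector.subspace W" "closed W" and v: "v \<notin> W"
  obtains u w c where "w \<in> W" "u = c *\<^sub>C (v - w)" "norm u = 1" "\<And>y. y \<in> W \<Longrightarrow> norm (u - y) \<ge> 1/2"
proof -
  have ne: "W \<noteq> {}" using W(1) complex_vector.subspace_0 by blast
  define d where "d = infdist v W"
  have d: "d > 0" unfolding d_def using W v ne by (intro infdist_pos_not_in_closed) auto
  have "\<exists>w\<in>W. dist v w < 2 * d"
  proof (rule ccontr)
    assume "\<not> (\<exists>w\<in>W. dist v w < 2 * d)"
    then have "2 * d \<le> infdist v W"
      using ne by (auto simp: infdist_def intro!: cINF_greatest)
    then show False using d by (simp add: d_def)
  qed
  then obtain w where w: "w \<in> W" "norm (v - w) < 2 * d" by (auto simp: dist_norm)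
  have nz: "norm (v - w) > 0" using v w by auto
  define c where "c = complex_of_real (inverse (norm (v - w)))"
  define u where "u = c *\<^sub>C (v - w)"
  have c: "cmod c = inverse (norm (v - w))" by (simp add: c_def norm_inverse)
  then have "norm u = 1" using nz by (simp add: u_def norm_scaleC)
  moreover have "norm (u - y) \<ge> 1/2" if "y \<in> W" for y
  proof -
    have "- (c *\<^sub>C w) - y \<in> W"
      using W(1) w that
      by (meson complex_vector.subspace_diff complex_vector.subspace_neg complex_vector.subspace_scale)
    from infdist_scaleC_le[OF W(1) this, of c v] have "cmod c * d \<le> norm (u - y)"
      by (simp add: d_def u_def scaleC_diff_right algebra_simps)
    moreover have "cmod c * d \<ge> 1/2" using w nz by (simp add: c field_simps)
    ultimately show ?thesis by linarith
  qed
  ultimately show ?thesis using that w u_def by blast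
qed

text \<open>A locally compact subspace is finite-dimensional: by Riesz's lemma, independent vectors would
  yield a bounded sequence whose members keep distance \<open>1/2\<close> from each other.\<close>

lemma locally_sequentially_compact_dependent:
  fixes W :: "'a::complex_banach_space set"
  assumes W: "complex_vector.subspace W" "locally_sequentially_compact W" and f: "\<And>n::nat. f n \<in> W"
  shows "\<exists>n. f n \<in> complex_vector.span (f ` {..<n})"
proof (rule ccontr)
  assume neg: "\<not> (\<exists>n. f n \<in> complex_vector.span (f ` {..<n}))"
  let ?M = "\<lambda>n::nat. complex_vector.span (f ` {..<n})"
  have mono: "?M m \<subseteq> ?M n" if "m \<le> n" for m n
    using that by (intro complex_vector.span_mono image_mono) auto
  have "\<exists>u. u \<in> ?M (Suc n) \<and> norm u = 1 \<and> (\<forall>y\<in>?M n. norm (u - y) \<ge> 1/2)" for n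
  proof -
    have "closed (?M n)"
      by (intro closed_if_locally_sequentially_compact locally_sequentially_compact_span) auto
    moreover have "f n \<notin> ?M n" using neg by blast
    ultimately obtain u w c where u: "w \<in> ?M n" "u = c *\<^sub>C (f n - w)" "norm u = 1"
        "\<And>y. y \<in> ?M n \<Longrightarrow> norm (u - y) \<ge> 1/2"
      by (metis Riesz_lemma[OF complex_vector.subspace_span])
    have "w \<in> ?M (Suc n)" using u(1) mono[of n "Suc n"] by auto
    then have "u \<in> ?M (Suc n)"
      unfolding u(2)
      by (intro complex_vector.span_scale complex_vector.span_diff) (auto intro: complex_vector.span_base)
    then show ?thesis using u by blast
  qed
  then obtain u where u: "\<And>n. u n \<in> ?M (Suc n)" "\<And>n. norm (u n) = 1"
      "\<And>n y. y \<in> ?M n \<Longrightarrow> norm (u n - y) \<ge> 1/2" by metis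
  have sep: "norm (u n - u m) \<ge> 1/2" if "m < n" for m n
    using u(1)[of m] mono[of "Suc m" n] that by (intro u(3)) auto
  have "u n \<in> W" for n
    using u(1)[of n] complex_vector.span_minimal[OF _ W(1), of "f ` {..<Suc n}"] f by auto
  moreover have "bounded (range u)" using u(2) by (auto simp: bounded_iff)
  ultimately obtain l r where "strict_mono r" "(u \<circ> r) \<longlonglongrightarrow> l"
    using locally_sequentially_compactD[OF W(2), of u] by blast
  then have "Cauchy (u \<circ> r)" using LIMSEQ_imp_Cauchy by blast
  then obtain N where N: "\<And>m n. m \<ge> N \<Longrightarrow> n \<ge> N \<Longrightarrow> norm ((u \<circ> r) m - (u \<circ> r) n) < 1/2"
    using CauchyD[of "u \<circ> r" "1/2"] by auto
  have "r N < r (Suc N)" using \<open>strict_mono r\<close> by (simp add: strict_mono_def)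
  from sep[OF this] N[of "Suc N" N] show False by simp
qed


section \<open>Operators whose powers tend to zero\<close>

text \<open>For bounded linear operators this is the upper half of the Fredholm property: the kernel is
  locally compact and the range is closed. It survives compact perturbations.\<close>

definition proper_on_bounded :: "('a::real_normed_vector \<Rightarrow> 'b::real_normed_vector) \<Rightarrow> bool" where
  "proper_on_bounded A \<longleftrightarrow> (\<forall>x::nat \<Rightarrow> 'a. bounded (range x) \<and> convergent (\<lambda>n. A (x n)) \<longrightarrow>
     (\<exists>r::nat \<Rightarrow> nat. strict_mono r \<and> convergent (x \<circ> r)))"

lemma proper_on_boundedD:
  assumes "proper_on_bounded A" "bounded (range x)" "(\<lambda>n. A (x n)) \<longlonglongrightarrow> y"
  obtains r :: "nat \<Rightarrow> nat" and l where "strict_mono r" "(x \<circ> r) \<longlonglongrightarrow> l"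
proof -
  have "convergent (\<lambda>n. A (x n))" using assms(3) by (auto simp: convergent_def)
  then obtain r :: "nat \<Rightarrow> nat" where "strict_mono r" "convergent (x \<circ> r)"
    using assms(1)[unfolded proper_on_bounded_def, rule_format, of x] assms(2) by auto
  then show ?thesis using that by (auto simp: convergent_def)
qed

text \<open>The bound is uniform because the parameter ranges over a compact set: approximate
  null vectors for parameters \<open>z n\<close> would accumulate at a null vector for a limit of \<open>z n\<close>.\<close>

lemma uniformly_bounded_below:
  fixes D :: "'a::complex_banach_space \<Rightarrow> 'a"
  assumes D: "bounded_clinear D" and Z: "compact Z"
    and proper: "\<And>z. z \<in> Z \<Longrightarrow> proper_on_bounded (\<lambda>x. x - z *\<^sub>C D x)"
    and inj: "\<And>z x. z \<in> Z \<Longrightarrow> x = z *\<^sub>C D x \<Longrightarrow> x = 0"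
  obtains d where "d > 0" "\<And>z x. z \<in> Z \<Longrightarrow> d * norm x \<le> norm (x - z *\<^sub>C D x)"
proof (rule ccontr)
  assume neg: "\<not> thesis"
  have "\<exists>z x. z \<in> Z \<and> norm x = 1 \<and> norm (x - z *\<^sub>C D x) < inverse (real (Suc n))" for n
  proof -
    have "\<not> (\<forall>z x. z \<in> Z \<longrightarrow> inverse (real (Suc n)) * norm x \<le> norm (x - z *\<^sub>C D x))"
      using neg that[of "inverse (real (Suc n))"] by auto
    then obtain z x where z: "z \<in> Z" "norm (x - z *\<^sub>C D x) < inverse (real (Suc n)) * norm x"
      by (auto simp: not_le)
    then have nz: "norm x > 0"
      by (metis mult_zero_right norm_ge_zero norm_zero not_less zero_less_norm_iff)
    define a where "a = complex_of_real (inverse (norm x))"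
    have a: "cmod a = inverse (norm x)" by (simp add: a_def norm_inverse)
    have "a *\<^sub>C x - z *\<^sub>C D (a *\<^sub>C x) = a *\<^sub>C (x - z *\<^sub>C D x)"
      by (simp add: bounded_clinear_scaleC[OF D] scaleC_diff_right mult.commute)
    then have "norm (a *\<^sub>C x - z *\<^sub>C D (a *\<^sub>C x)) = norm (x - z *\<^sub>C D x) / norm x"
      by (simp add: norm_scaleC a divide_inverse mult.commute)
    also have "\<dots> < inverse (real (Suc n))" using z nz by (simp add: field_simps)
    finally show ?thesis using z nz a
      by (intro exI[of _ z] exI[of _ "a *\<^sub>C x"]) (auto simp: norm_scaleC)
  qed
  then obtain z x where z: "\<And>n. z n \<in> Z" and x: "\<And>n. norm (x n) = 1"
    and small: "\<And>n. norm (x n - z n *\<^sub>C D (x n)) < inverse (real (Suc n))" by metis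
  obtain K where K: "K > 0" "\<And>x. norm (D x) \<le> K * norm x" using bounded_clinear_bound[OF D] by blast
  obtain l s where l: "l \<in> Z" and s: "strict_mono s" "(z \<circ> s) \<longlonglongrightarrow> l"
    using Z z unfolding compact_def by metis
  have lim: "(\<lambda>n. x (s n) - l *\<^sub>C D (x (s n))) \<longlonglongrightarrow> 0"
  proof (rule Lim_null_comparison)
    show "\<forall>\<^sub>F n in sequentially. norm (x (s n) - l *\<^sub>C D (x (s n)))
        \<le> inverse (real (Suc (s n))) + cmod (z (s n) - l) * K"
    proof (intro always_eventually allI)
      fix n
      have eq: "x (s n) - l *\<^sub>C D (x (s n)) =
          (x (s n) - z (s n) *\<^sub>C D (x (s n))) + (z (s n) - l) *\<^sub>C D (x (s n))"
        by (simp add: scaleC_diff_left)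
      have "norm ((z (s n) - l) *\<^sub>C D (x (s n))) \<le> cmod (z (s n) - l) * K"
        using mult_left_mono[OF K(2)[of "x (s n)"], of "cmod (z (s n) - l)"]
        by (simp add: norm_scaleC x)
      then show "norm (x (s n) - l *\<^sub>C D (x (s n)))
          \<le> inverse (real (Suc (s n))) + cmod (z (s n) - l) * K"
        unfolding eq using small[of "s n"] norm_triangle_ineq[of "x (s n) - z (s n) *\<^sub>C D (x (s n))"
            "(z (s n) - l) *\<^sub>C D (x (s n))"] by linarith
    qed
    have "(\<lambda>n. inverse (real (Suc (s n)))) \<longlonglongrightarrow> 0"
      using LIMSEQ_subseq_LIMSEQ[OF LIMSEQ_inverse_real_of_nat s(1)] by (simp add: comp_def)
    moreover have "(\<lambda>n. cmod (z (s n) - l) * K) \<longlonglongrightarrow> 0"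
      using s(2) tendsto_mult_left_zero[OF tendsto_norm_zero[OF LIM_zero[of "\<lambda>n. z (s n)" l]]]
      by (simp add: comp_def)
    ultimately show "(\<lambda>n. inverse (real (Suc (s n))) + cmod (z (s n) - l) * K) \<longlonglongrightarrow> 0"
      by (rule tendsto_add_zero)
  qed
  have "bounded (range (\<lambda>n. x (s n)))" using x by (auto simp: bounded_iff)
  from proper_on_boundedD[OF proper[OF l] this lim]
  obtain r :: "nat \<Rightarrow> nat" and y where r: "strict_mono r" "((\<lambda>n. x (s n)) \<circ> r) \<longlonglongrightarrow> y" by blast
  then have xr: "(\<lambda>n. x (s (r n))) \<longlonglongrightarrow> y" by (simp add: comp_def)
  have "norm y = 1"
    using tendsto_norm[OF xr] by (simp add: x LIMSEQ_const_iff)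
  have "(\<lambda>n. x (s (r n)) - l *\<^sub>C D (x (s (r n)))) \<longlonglongrightarrow> y - l *\<^sub>C D y"
    by (intro tendsto_diff xr bounded_clinear_tendsto[OF bounded_clinear_of_scaleC[OF D]])
  moreover have "(\<lambda>n. x (s (r n)) - l *\<^sub>C D (x (s (r n)))) \<longlonglongrightarrow> 0"
    using LIMSEQ_subseq_LIMSEQ[OF lim r(1)] by (simp add: comp_def)
  ultimately have "y - l *\<^sub>C D y = 0" by (rule LIMSEQ_unique)
  with inj[OF l, of y] \<open>norm y = 1\<close> show False by simp
qed

text \<open>Surjectivity spreads from \<open>z = 0\<close> along a radius in finitely many steps, since the
  uniform lower bound fixes the size of an admissible step.\<close>

lemma surj_if_uniformly_bounded_below:
  fixes D :: "'a::complex_banach_space \<Rightarrow> 'a"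
  assumes D: "bounded_clinear D" and d: "d > 0"
    and below: "\<And>z x. cmod z \<le> 1 \<Longrightarrow> d * norm x \<le> norm (x - z *\<^sub>C D x)" and z: "cmod z \<le> 1"
  shows "surj (\<lambda>x. x - z *\<^sub>C D x)"
proof -
  obtain K where K: "K > 0" "\<And>x. norm (D x) \<le> K * norm x" using bounded_clinear_bound[OF D] by blast
  obtain N :: nat where N: "real N > K / d" using reals_Archimedean2 by blast
  have N0: "N > 0" using N K d by (metis divide_pos_pos less_trans of_nat_0_less_iff)
  let ?z = "\<lambda>k. complex_of_real (real k / real N) * z"
  have lin: "bounded_clinear (\<lambda>x. x - c *\<^sub>C D x)" for c
    by (intro bounded_clinear_minus_op bounded_clinear_ident bounded_clinear_of_scaleC D)
  have "surj (\<lambda>x. x - ?z k *\<^sub>C D x)" if "k \<le> N" for k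
    using that
  proof (induction k)
    case 0
    then show ?case by simp
  next
    case (Suc k)
    let ?e = "- complex_of_real (1 / real N) * z"
    have "cmod (?z k) = real k / real N * cmod z" by (simp add: norm_mult norm_divide)
    also have "\<dots> \<le> 1" using z Suc.prems N0 by (intro mult_le_one) auto
    finally have zk: "cmod (?z k) \<le> 1" .
    have "surj (\<lambda>x. (x - ?z k *\<^sub>C D x) + ?e *\<^sub>C D x)"
    proof (rule bounded_below_surj_perturb[OF lin bounded_clinear_of_scaleC[OF D] below[OF zk]])
      show "surj (\<lambda>x. x - ?z k *\<^sub>C D x)" using Suc by simp
      have e: "cmod ?e \<le> 1 / real N" using z by (simp add: norm_mult norm_divide divide_right_mono)
      show "norm (?e *\<^sub>C D x) \<le> (K / real N) * norm x" for x
        using mult_mono[OF e K(2)[of x]] by (simp add: norm_scaleC)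
      show "K / real N < d" using N N0 d by (simp add: field_simps)
    qed (use K N0 in auto)
    moreover have "(x - ?z k *\<^sub>C D x) + ?e *\<^sub>C D x = x - ?z (Suc k) *\<^sub>C D x" for x
    proof -
      have "?z (Suc k) = ?z k - ?e" using N0 by (simp add: field_simps)
      then show ?thesis by (simp only: scaleC_diff_left) simp
    qed
    ultimately show ?case by (simp only:)
  qed
  from this[of N] N0 show ?thesis by simp
qed

lemma sum_roots_of_unity_powers:
  fixes n j :: nat
  assumes "j < n"
  shows "(\<Sum>k<n. cis (2 * pi / real n) ^ (k * j)) = (if j = 0 then of_nat n else 0)"
proof (cases "j = 0")
  case False
  let ?w = "cis (2 * pi * real j / real n)"
  have w: "cis (2 * pi / real n) ^ (k * j) = ?w ^ k" for k
    by (simp add: Complex.DeMoivre mult_ac)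
  have "?w \<noteq> 1"
  proof
    assume "?w = 1"
    then have "cos (2 * pi * real j / real n) = 1" by (metis cis.simps(1) one_complex.simps(1))
    then obtain m :: int where m: "2 * pi * real j / real n = real_of_int m * 2 * pi"
      by (auto simp: cos_one_2pi_int)
    then have "real j = real_of_int m * real n" using assms by (simp add: field_simps)
    then have jm: "int j = m * int n" by (metis of_int_eq_iff of_int_mult of_int_of_nat_eq)
    then have "int n dvd int j" by simp
    then show False using assms False by (auto dest: dvd_imp_le)
  qed
  moreover have "?w ^ n = 1"
    using assms by (simp add: Complex.DeMoivre cis_multiple_2pi)
  ultimately show ?thesis using False
    unfolding w by (simp add: geometric_sum)
qed auto

context
  fixes D :: "'a::complex_banach_space \<Rightarrow> 'a" and d :: real
  assumes D: "bounded_clinear D" and d: "d > 0"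
    and below: "\<And>z x. cmod z \<le> 1 \<Longrightarrow> d * norm x \<le> norm (x - z *\<^sub>C D x)"
begin

definition disc_resolvent :: "complex \<Rightarrow> 'a \<Rightarrow> 'a" where
  "disc_resolvent z = inv (\<lambda>x. x - z *\<^sub>C D x)"

definition averaged_resolvent :: "nat \<Rightarrow> complex \<Rightarrow> 'a \<Rightarrow> 'a" where
  "averaged_resolvent n z x =
     (1 / of_nat n) *\<^sub>C (\<Sum>k<n. disc_resolvent (cis (2 * pi / real n) ^ k * z) x)"

lemma resolvent_operator: "bounded_clinear (\<lambda>x. x - z *\<^sub>C D x)"
  by (intro bounded_clinear_minus_op bounded_clinear_ident bounded_clinear_of_scaleC D)

lemma disc_resolvent:
  assumes "cmod z \<le> 1"
  shows "bounded_clinear (disc_resolvent z)"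
    and "disc_resolvent z x - z *\<^sub>C D (disc_resolvent z x) = x"
    and "disc_resolvent z (x - z *\<^sub>C D x) = x"
    and "norm (disc_resolvent z x) \<le> norm x / d"
proof -
  define A where "A = (\<lambda>x. x - z *\<^sub>C D x)"
  have A: "bounded_clinear A" "\<And>x. d * norm x \<le> norm (A x)" "surj A"
    using resolvent_operator[of z] below[OF assms]
      surj_if_uniformly_bounded_below[OF D d below assms] by (simp_all add: A_def)
  have R: "disc_resolvent z = inv A" by (simp add: disc_resolvent_def A_def)
  note inv = bounded_clinear_inv[OF A(1) d A(2,3)]
  show "bounded_clinear (disc_resolvent z)" unfolding R by (rule inv(1))
  show "disc_resolvent z x - z *\<^sub>C D (disc_resolvent z x) = x"
    using inv(2)[of x] by (simp only: R A_def)
  show "disc_resolvent z (x - z *\<^sub>C D x) = x" using inv(3)[of x] by (simp only: R A_def)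
  show "norm (disc_resolvent z x) \<le> norm x / d" unfolding R by (rule inv(4))
qed

lemma disc_resolvent_Lipschitz:
  obtains L where "L > 0"
    "\<And>z w x. cmod z \<le> 1 \<Longrightarrow> cmod w \<le> 1 \<Longrightarrow>
       norm (disc_resolvent z x - disc_resolvent w x) \<le> L * cmod (z - w) * norm x"
proof -
  obtain K where K: "K > 0" "\<And>x. norm (D x) \<le> K * norm x" using bounded_clinear_bound[OF D] by blast
  have "norm (disc_resolvent z x - disc_resolvent w x) \<le> K / (d * d) * cmod (z - w) * norm x"
    if z: "cmod z \<le> 1" and w: "cmod w \<le> 1" for z w x
  proof -
    define u where "u = disc_resolvent w x"
    have "x - (u - z *\<^sub>C D u) = (z - w) *\<^sub>C D u"
      using disc_resolvent(2)[OF w, of x] by (simp add: u_def scaleC_diff_left algebra_simps)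
    then have "disc_resolvent z x - u = disc_resolvent z ((z - w) *\<^sub>C D u)"
      using bounded_clinear_diff[OF disc_resolvent(1)[OF z], of x "u - z *\<^sub>C D u"] disc_resolvent(3)[OF z, of u]
      by simp
    then have "norm (disc_resolvent z x - u) \<le> cmod (z - w) * norm (D u) / d"
      using disc_resolvent(4)[OF z, of "(z - w) *\<^sub>C D u"] by (simp add: norm_scaleC)
    also have "norm (D u) \<le> K * (norm x / d)"
      using K(2)[of u] disc_resolvent(4)[OF w, of x] K(1) unfolding u_def
      by (meson mult_left_mono order_trans less_imp_le)
    then have "cmod (z - w) * norm (D u) / d \<le> cmod (z - w) * (K * (norm x / d)) / d"
      using d by (intro divide_right_mono mult_left_mono) auto
    finally show ?thesis by (simp add: u_def field_simps)
  qed
  moreover have "K / (d * d) > 0" using K d by simp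
  ultimately show ?thesis using that by blast
qed

lemma averaged_resolvent_norm_diff:
  assumes n: "n > 0" and "\<And>k. k < n \<Longrightarrow> norm (disc_resolvent (cis (2 * pi / real n) ^ k * z) x -
         disc_resolvent (cis (2 * pi / real n) ^ k * w) x) \<le> B"
  shows "norm (averaged_resolvent n z x - averaged_resolvent n w x) \<le> B"
proof -
  have "averaged_resolvent n z x - averaged_resolvent n w x =
      (1 / of_nat n) *\<^sub>C (\<Sum>k<n. disc_resolvent (cis (2 * pi / real n) ^ k * z) x -
         disc_resolvent (cis (2 * pi / real n) ^ k * w) x)"
    by (simp add: averaged_resolvent_def scaleC_diff_right sum_subtractf)
  also have "norm \<dots> \<le> (1 / real n) * (real n * B)"
    unfolding norm_scaleC
    using assms sum_norm_le[of "{..<n}" "\<lambda>k. disc_resolvent (cis (2 * pi / real n) ^ k * z) x -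
         disc_resolvent (cis (2 * pi / real n) ^ k * w) x" "\<lambda>_. B"]
    by (intro mult_mono) (auto simp: norm_divide)
  finally show ?thesis using n by simp
qed

text \<open>Averaging the geometric series \<open>(1 - \<omega> z D)\<^sup>-\<^sup>1 (1 - z\<^sup>n D\<^sup>n) = \<Sum>j<n. (\<omega> z D)\<^sup>j\<close> over the \<open>n\<close>-th
  roots of unity \<open>\<omega>\<close> leaves the term \<open>j = 0\<close> only, so the averaged resolvent inverts
  \<open>1 - z\<^sup>n D\<^sup>n\<close>.\<close>

lemma averaged_resolvent_inverts:
  assumes n: "n > 0" and z: "cmod z \<le> 1"
  shows "averaged_resolvent n z (x - z ^ n *\<^sub>C (D ^^ n) x) = x"
proof -
  define w where "w = cis (2 * pi / real n)"
  have wn: "w ^ n = 1" using n by (simp add: w_def Complex.DeMoivre)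
  have res: "disc_resolvent (w ^ k * z) (x - z ^ n *\<^sub>C (D ^^ n) x) =
      (\<Sum>j<n. (w ^ k * z) ^ j *\<^sub>C (D ^^ j) x)" for k
  proof -
    let ?c = "w ^ k * z"
    have c: "cmod ?c \<le> 1" using z by (simp add: w_def norm_mult norm_power)
    let ?s = "\<Sum>j<n. ?c ^ j *\<^sub>C (D ^^ j) x"
    have "?s - ?c *\<^sub>C D ?s = (\<Sum>j<n. ?c ^ j *\<^sub>C (D ^^ j) x - ?c ^ Suc j *\<^sub>C (D ^^ Suc j) x)"
      by (simp add: bounded_clinear_simps[OF D] scaleC_sum_right sum_subtractf mult.commute)
    also have "\<dots> = x - ?c ^ n *\<^sub>C (D ^^ n) x"
      using sum_lessThan_telescope'[of "\<lambda>j. ?c ^ j *\<^sub>C (D ^^ j) x" n] by simp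
    also have "?c ^ n = z ^ n"
      using wn by (simp add: power_mult_distrib) (metis mult.commute power_mult power_one)
    finally show ?thesis using disc_resolvent(3)[OF c, of ?s] by simp
  qed
  have "(\<Sum>k<n. disc_resolvent (w ^ k * z) (x - z ^ n *\<^sub>C (D ^^ n) x)) =
      (\<Sum>j<n. \<Sum>k<n. (w ^ k * z) ^ j *\<^sub>C (D ^^ j) x)"
    unfolding res by (rule sum.swap)
  also have "\<dots> = (\<Sum>j<n. \<Sum>k<n. (z ^ j * w ^ (k * j)) *\<^sub>C (D ^^ j) x)"
    by (simp only: power_mult_distrib power_mult mult.commute[of "z ^ _"])
  also have "\<dots> = (\<Sum>j<n. (z ^ j * (\<Sum>k<n. w ^ (k * j))) *\<^sub>C (D ^^ j) x)"
    by (simp add: scaleC_sum_left[symmetric] sum_distrib_left)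
  also have "\<dots> = (\<Sum>j<n. if j = 0 then of_nat n *\<^sub>C x else 0)"
    by (intro sum.cong) (auto simp: w_def sum_roots_of_unity_powers)
  also have "\<dots> = of_nat n *\<^sub>C x" using n by simp
  finally show ?thesis using n by (simp add: averaged_resolvent_def w_def)
qed

definition powers_vanish :: "real \<Rightarrow> bool" where
  "powers_vanish t \<longleftrightarrow>
     (\<forall>e>0. \<forall>\<^sub>F n in sequentially. \<forall>x. norm (complex_of_real t ^ n *\<^sub>C (D ^^ n) x) \<le> e * norm x)"

text \<open>If \<open>t\<^sup>n D\<^sup>n\<close> tends to zero, then the averaged resolvents at \<open>t\<close> tend to the identity. They
  are equicontinuous in \<open>t\<close>, so at a nearby \<open>s\<close> they stay close to it, and
  hence so do their inverses \<open>1 - s\<^sup>n D\<^sup>n\<close>.\<close>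

lemma powers_small_nearby:
  assumes L: "\<And>z w x. cmod z \<le> 1 \<Longrightarrow> cmod w \<le> 1 \<Longrightarrow>
       norm (disc_resolvent z x - disc_resolvent w x) \<le> L * cmod (z - w) * norm x"
    and t: "powers_vanish t" and ts: "0 \<le> t" "t \<le> s" "s \<le> 1"
    and e: "0 < e" "e \<le> 1/2" "L * (s - t) \<le> e / 2"
  shows "\<forall>\<^sub>F n in sequentially. \<forall>x. norm (complex_of_real s ^ n *\<^sub>C (D ^^ n) x) \<le> 2 * e * norm x"
proof -
  have "\<forall>\<^sub>F n in sequentially. \<forall>x. norm (complex_of_real t ^ n *\<^sub>C (D ^^ n) x) \<le> (e * d / 2) * norm x"
    using t[unfolded powers_vanish_def, rule_format, of "e * d / 2"] e d by simp
  then show ?thesis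
    using eventually_gt_at_top[of 0]
  proof eventually_elim
    fix n :: nat
    assume small: "\<forall>x. norm (complex_of_real t ^ n *\<^sub>C (D ^^ n) x) \<le> (e * d / 2) * norm x"
      and n: "0 < n"
    let ?t = "complex_of_real t" and ?s = "complex_of_real s" and ?G = "averaged_resolvent n"
    have s1: "cmod ?s \<le> 1" and t1: "cmod ?t \<le> 1" using ts by auto
    have unit: "cmod (cis (2 * pi / real n) ^ k * c) = cmod c" for k c
      by (simp add: norm_mult norm_power)
    have G: "norm (?G ?t x) \<le> norm x / d" for x
    proof -
      have "norm (\<Sum>k<n. disc_resolvent (cis (2 * pi / real n) ^ k * ?t) x) \<le> (\<Sum>k<n. norm x / d)"
        using t1 by (intro sum_norm_le disc_resolvent(4)) (simp only: unit)
      then show ?thesis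
        using n by (simp add: averaged_resolvent_def norm_scaleC norm_divide field_simps)
    qed
    have Glin: "?G ?t (x - y) = ?G ?t x - ?G ?t y" for x y
      using t1 by (simp add: averaged_resolvent_def bounded_clinear_diff[OF disc_resolvent(1)] unit
          sum_subtractf scaleC_diff_right)
    have close_t: "norm (?G ?t x - x) \<le> e / 2 * norm x" for x
    proof -
      have "?G ?t x - x = ?G ?t (?t ^ n *\<^sub>C (D ^^ n) x)"
        using averaged_resolvent_inverts[OF n t1, of x] by (simp add: Glin algebra_simps)
      then have "norm (?G ?t x - x) \<le> norm (?t ^ n *\<^sub>C (D ^^ n) x) / d" using G by simp
      also have "\<dots> \<le> (e * d / 2) * norm x / d" using small d by (intro divide_right_mono) auto
      finally show ?thesis using d by simp
    qed
    have close_st: "norm (?G ?s x - ?G ?t x) \<le> e / 2 * norm x" for x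
    proof (rule averaged_resolvent_norm_diff[OF n])
      fix k assume "k < n"
      let ?w = "cis (2 * pi / real n) ^ k"
      have "norm (disc_resolvent (?w * ?s) x - disc_resolvent (?w * ?t) x) \<le>
          L * cmod (?w * ?s - ?w * ?t) * norm x"
        by (rule L) (use s1 t1 in \<open>simp_all only: unit\<close>)
      also have "cmod (?w * ?s - ?w * ?t) = cmod (?s - ?t)"
        unfolding right_diff_distrib[symmetric] by (rule unit)
      also have "cmod (?s - ?t) = s - t"
        using ts by (metis abs_of_nonneg diff_ge_0_iff_ge norm_of_real of_real_diff)
      also have "L * (s - t) * norm x \<le> e / 2 * norm x" using e by (intro mult_right_mono) auto
      finally show "norm (disc_resolvent (?w * ?s) x - disc_resolvent (?w * ?t) x) \<le> e / 2 * norm x" .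
    qed
    show "\<forall>y. norm (?s ^ n *\<^sub>C (D ^^ n) y) \<le> 2 * e * norm y"
    proof
      fix y
      let ?p = "?s ^ n *\<^sub>C (D ^^ n) y"
      define v where "v = y - ?p"
      have "?G ?s v = y" unfolding v_def by (rule averaged_resolvent_inverts[OF n s1])
      then have "?p = (?G ?s v - ?G ?t v) + (?G ?t v - v)" by (simp add: v_def)
      then have "norm ?p \<le> norm (?G ?s v - ?G ?t v) + norm (?G ?t v - v)"
        by (metis norm_triangle_ineq)
      also have "\<dots> \<le> e * norm v"
        using close_st[of v] close_t[of v] by simp
      also have "\<dots> \<le> e * (norm y + norm ?p)"
        using e unfolding v_def by (intro mult_left_mono norm_triangle_ineq4) auto
      finally have a: "norm ?p \<le> e * norm y + e * norm ?p" by (simp add: algebra_simps)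
      have "e * norm ?p \<le> 1/2 * norm ?p" using e by (intro mult_right_mono) auto
      then show "norm ?p \<le> 2 * e * norm y" using a by linarith
    qed
  qed
qed

lemma powers_vanish_below:
  assumes ev: "\<forall>\<^sub>F n in sequentially. \<forall>x. norm (complex_of_real s ^ n *\<^sub>C (D ^^ n) x) \<le> norm x"
    and t: "0 \<le> t" "t < s"
  shows "powers_vanish t"
  unfolding powers_vanish_def
proof (intro allI impI)
  fix e :: real assume e: "e > 0"
  have "(\<lambda>n. (t / s) ^ n) \<longlonglongrightarrow> 0" using t by (intro LIMSEQ_realpow_zero) auto
  then have "\<forall>\<^sub>F n in sequentially. (t / s) ^ n < e" using e by (rule order_tendstoD)
  with ev show "\<forall>\<^sub>F n in sequentially. \<forall>x. norm (complex_of_real t ^ n *\<^sub>C (D ^^ n) x) \<le> e * norm x"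
  proof eventually_elim
    fix n assume s: "\<forall>x. norm (complex_of_real s ^ n *\<^sub>C (D ^^ n) x) \<le> norm x" and q: "(t / s) ^ n < e"
    show "\<forall>x. norm (complex_of_real t ^ n *\<^sub>C (D ^^ n) x) \<le> e * norm x"
    proof
      fix x
      have "norm (complex_of_real t ^ n *\<^sub>C (D ^^ n) x) =
          (t / s) ^ n * norm (complex_of_real s ^ n *\<^sub>C (D ^^ n) x)"
        using t by (simp add: norm_scaleC norm_power power_divide)
      also have "\<dots> \<le> e * norm x" using s q t e by (intro mult_mono) auto
      finally show "norm (complex_of_real t ^ n *\<^sub>C (D ^^ n) x) \<le> e * norm x" .
    qed
  qed
qed

text \<open>The spectral radius formula at the radius \<open>1\<close>: decay of \<open>t\<^sup>n D\<^sup>n\<close> at \<open>t = 0\<close> is propagated to \<open>t = 1\<close>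
  in steps of a fixed length \<open>1/N\<close>, which is determined by \<open>e\<close> and the Lipschitz constant of the
  resolvent. Each step first gains boundedness at the distance \<open>2/N\<close> and then falls back to
  \<open>1/N\<close> to regain decay.\<close>

lemma powers_tend_to_zero:
  assumes "e > 0"
  shows "\<forall>\<^sub>F n in sequentially. \<forall>x. norm ((D ^^ n) x) \<le> e * norm x"
proof -
  obtain L where L: "L > 0" "\<And>z w x. cmod z \<le> 1 \<Longrightarrow> cmod w \<le> 1 \<Longrightarrow>
       norm (disc_resolvent z x - disc_resolvent w x) \<le> L * cmod (z - w) * norm x"
    by (rule disc_resolvent_Lipschitz) blast
  define e' where "e' = min e 1 / 2"
  have e': "0 < e'" "e' \<le> 1/2" "2 * e' \<le> e" using assms by (auto simp: e'_def)
  obtain N :: nat where N: "real N > 4 * L / e'" using reals_Archimedean2 by blast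
  have "real N > 0" using N L e' by (smt (verit) divide_pos_pos)
  then have N0: "N > 0" by simp
  have step: "L * (2 / real N) \<le> e' / 2" using N N0 e' by (simp add: field_simps)
  have step1: "L * (1 / real N) \<le> e' / 2"
    using step L N0 by (smt (verit) divide_right_mono mult_left_mono of_nat_0_le_iff)
  have "powers_vanish (real k / real N)" if "k < N" for k
    using that
  proof (induction k)
    case 0
    have "\<forall>\<^sub>F n in sequentially. \<forall>x. norm (complex_of_real 0 ^ n *\<^sub>C (D ^^ n) x) \<le> \<epsilon> * norm x"
      if "\<epsilon> > 0" for \<epsilon>
      by (rule eventually_mono[OF eventually_gt_at_top[of 0]]) (use that in \<open>auto simp: zero_power\<close>)
    then show ?case by (simp add: powers_vanish_def)
  next
    case (Suc k)
    have "\<forall>\<^sub>F n in sequentially. \<forall>x. norm (complex_of_real (real (Suc (Suc k)) / real N) ^ n *\<^sub>C (D ^^ n) x)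
        \<le> 2 * (1/2) * norm x"
    proof (rule powers_small_nearby[OF L(2)])
      show "powers_vanish (real k / real N)" using Suc by simp
      have "real (Suc (Suc k)) / real N - real k / real N = 2 / real N"
        by (simp add: diff_divide_distrib[symmetric])
      then show "L * (real (Suc (Suc k)) / real N - real k / real N) \<le> 1/2 / 2"
        using step e' by simp
      show "real (Suc (Suc k)) / real N \<le> 1" using Suc.prems by simp
    qed (auto simp: divide_right_mono)
    then show ?case
      by (intro powers_vanish_below[of "real (Suc (Suc k)) / real N"])
         (use N0 in \<open>auto simp: divide_strict_right_mono\<close>)
  qed
  from this[of "N - 1"] have "powers_vanish (real (N - 1) / real N)" using N0 by simp
  moreover have "1 - real (N - 1) / real N = 1 / real N" using N0 by (simp add: of_nat_diff field_simps)
  then have "L * (1 - real (N - 1) / real N) \<le> e' / 2" using step1 by simp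
  ultimately have "\<forall>\<^sub>F n in sequentially. \<forall>x.
      norm (complex_of_real 1 ^ n *\<^sub>C (D ^^ n) x) \<le> 2 * e' * norm x"
    using L e' N0 by (intro powers_small_nearby[where L = L and t = "real (N - 1) / real N"]) auto
  then show ?thesis
  proof eventually_elim
    fix n assume a: "\<forall>x. norm (complex_of_real 1 ^ n *\<^sub>C (D ^^ n) x) \<le> 2 * e' * norm x"
    show "\<forall>x. norm ((D ^^ n) x) \<le> e * norm x"
    proof
      fix x
      have "norm ((D ^^ n) x) \<le> 2 * e' * norm x" using a by simp
      also have "\<dots> \<le> e * norm x" using e' by (intro mult_right_mono) auto
      finally show "norm ((D ^^ n) x) \<le> e * norm x" .
    qed
  qed
qed

end


section \<open>Characters from minimal seminorms\<close>

text \<open>The bound at \<open>1\<close> excludes the zero seminorm by a condition that passes to infima of chains. The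
  inequality for scalar multiples implies equality.\<close>

definition algebra_seminorm :: "('a::comm_complex_banach_algebra_1 \<Rightarrow> real) \<Rightarrow> bool" where
  "algebra_seminorm p \<longleftrightarrow> (\<forall>x y. p (x + y) \<le> p x + p y) \<and> (\<forall>c x. p (c *\<^sub>C x) \<le> cmod c * p x) \<and>
     (\<forall>x y. p (x * y) \<le> p x * p y) \<and> (\<forall>x. 0 \<le> p x \<and> p x \<le> norm x) \<and> 1 \<le> p 1"

lemma algebra_seminormD:
  assumes "algebra_seminorm p"
  shows "p (x + y) \<le> p x + p y" "p (c *\<^sub>C x) \<le> cmod c * p x" "p (x * y) \<le> p x * p y"
    "0 \<le> p x" "p x \<le> norm x" "1 \<le> p 1"
  using assms by (auto simp: algebra_seminorm_def)

lemma algebra_seminorm_scaleC: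
  assumes p: "algebra_seminorm p"
  shows "p (c *\<^sub>C x) = cmod c * p x"
proof (cases "c = 0")
  case True
  then show ?thesis using algebra_seminormD(2)[OF p, of 0 x] algebra_seminormD(4)[OF p, of 0] by simp
next
  case False
  have "p (inverse c *\<^sub>C c *\<^sub>C x) \<le> cmod (inverse c) * p (c *\<^sub>C x)"
    by (rule algebra_seminormD(2)[OF p])
  then have "cmod c * p x \<le> p (c *\<^sub>C x)" using False by (simp add: norm_divide field_simps)
  then show ?thesis using algebra_seminormD(2)[OF p, of c x] by simp
qed

lemma algebra_seminorm_minus:
  assumes p: "algebra_seminorm p"
  shows "p (- x) = p x"
  using algebra_seminorm_scaleC[OF p, of "-1" x] by simp

lemma algebra_seminorm_triangle_diff:
  assumes p: "algebra_seminorm p"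
  shows "\<bar>p x - p y\<bar> \<le> p (x - y)"
  using algebra_seminormD(1)[OF p, of "x - y" y] algebra_seminormD(1)[OF p, of "y - x" x]
    algebra_seminorm_minus[OF p, of "x - y"] by simp

lemma algebra_seminorm_power:
  assumes p: "algebra_seminorm p"
  shows "p (x ^ n) \<le> p 1 * p x ^ n"
proof (induction n)
  case (Suc n)
  have "p (x ^ Suc n) \<le> p x * p (x ^ n)" using algebra_seminormD(3)[OF p] by simp
  also have "\<dots> \<le> p x * (p 1 * p x ^ n)"
    by (intro mult_left_mono Suc algebra_seminormD(4)[OF p])
  finally show ?case by (simp add: mult_ac)
qed simp

lemma algebra_seminorm_sum:
  assumes p: "algebra_seminorm p" and "finite I"
  shows "p (\<Sum>i\<in>I. f i) \<le> (\<Sum>i\<in>I. p (f i))"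
  using assms(2)
proof (induction I)
  case empty
  then show ?case using algebra_seminorm_scaleC[OF p, of 0 0] by simp
next
  case (insert i I)
  then show ?case using algebra_seminormD(1)[OF p, of "f i" "sum f I"] by simp
qed

lemma algebra_seminorm_of_nat_mult:
  assumes p: "algebra_seminorm p"
  shows "p (of_nat n * x) = real n * p x"
proof -
  have "of_nat n * x = of_nat n *\<^sub>C x" for n
    by (induction n) (auto simp: scaleC_add_left distrib_right)
  then show ?thesis using algebra_seminorm_scaleC[OF p, of "of_nat n" x] by simp
qed

definition minimal_seminorm :: "('a::comm_complex_banach_algebra_1 \<Rightarrow> real) \<Rightarrow> bool" where
  "minimal_seminorm p \<longleftrightarrow>
     algebra_seminorm p \<and> (\<forall>q. algebra_seminorm q \<and> (\<forall>x. q x \<le> p x) \<longrightarrow> q = p)"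

text \<open>Zorn's lemma applies because the pointwise infimum of a chain is an algebra seminorm: for any
  two arguments, one member of the chain is close to the infimum at both.\<close>

lemma minimal_seminorm_exists:
  assumes p: "algebra_seminorm p"
  obtains q where "minimal_seminorm q" "\<And>x. q x \<le> p x"
proof -
  define A where "A = {q. algebra_seminorm q \<and> (\<forall>x. q x \<le> p x)}"
  define r where "r = (\<lambda>f g :: 'a \<Rightarrow> real. \<forall>x. g x \<le> f x)"
  have "\<exists>m\<in>A. \<forall>a\<in>A. r m a \<longrightarrow> a = m"
  proof (rule predicate_Zorn)
    show "partial_order_on A (relation_of r A)"
      unfolding r_def
      by (rule partial_order_on_relation_ofI) (auto simp: fun_eq_iff intro: order_trans antisym)
    fix C assume C: "C \<in> Chains (relation_of r A)"
    then have CA: "C \<subseteq> A" by (auto simp: Chains_def relation_of_def)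
    have chain: "(\<forall>x. f x \<le> g x) \<or> (\<forall>x. g x \<le> f x)" if "f \<in> C" "g \<in> C" for f g
      using C that by (auto simp: Chains_def relation_of_def r_def)
    show "\<exists>u\<in>A. \<forall>a\<in>C. r a u"
    proof (cases "C = {}")
      case True
      then show ?thesis using p by (auto simp: A_def)
    next
      case False
      define u where "u = (\<lambda>x. INF f\<in>C. f x)"
      have sem: "algebra_seminorm f" if "f \<in> C" for f using CA that by (auto simp: A_def)
      have bdd: "bdd_below ((\<lambda>f. f x) ` C)" for x
        using algebra_seminormD(4)[OF sem] by (auto intro!: bdd_belowI[of _ 0])
      have le: "u x \<le> f x" if "f \<in> C" for f x
        unfolding u_def using that bdd by (auto intro: cINF_lower)
      have ge: "b \<le> u x" if "\<And>f. f \<in> C \<Longrightarrow> b \<le> f x" for b x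
        unfolding u_def using False that by (auto intro: cINF_greatest)
      have approx: "\<exists>f\<in>C. f x < u x + e \<and> f y < u y + e" if "e > 0" for e x y
      proof -
        have one: "\<exists>f\<in>C. f x < u x + e" for x
        proof (rule ccontr)
          assume "\<not> (\<exists>f\<in>C. f x < u x + e)"
          then have "u x + e \<le> u x" by (intro ge) (auto simp: not_less)
          then show False using that by simp
        qed
        obtain f g where "f \<in> C" "f x < u x + e" "g \<in> C" "g y < u y + e"
          using one by meson
        then show ?thesis using chain[of f g] by (meson order_le_less_trans)
      qed
      have nonneg: "0 \<le> u x" for x by (intro ge algebra_seminormD(4) sem)
      have add: "u (x + y) \<le> u x + u y" for x y
      proof (rule field_le_epsilon)
        fix e :: real assume "e > 0"
        then obtain f where f: "f \<in> C" "f x < u x + e/2" "f y < u y + e/2"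
          using approx[of "e/2" x y] by auto
        then show "u (x + y) \<le> u x + u y + e"
          using le[OF f(1), of "x + y"] algebra_seminormD(1)[OF sem[OF f(1)], of x y] by linarith
      qed
      have mult: "u (x * y) \<le> u x * u y" for x y
      proof -
        have "u (x * y) \<le> (u x + e) * (u y + e)" if "e > 0" for e
        proof -
          obtain f where f: "f \<in> C" "f x < u x + e" "f y < u y + e"
            using approx[OF \<open>e > 0\<close>, of x y] by auto
          have "u (x * y) \<le> f x * f y"
            using le[OF f(1), of "x * y"] algebra_seminormD(3)[OF sem[OF f(1)], of x y] by linarith
          also have "\<dots> \<le> (u x + e) * (u y + e)"
            using f nonneg[of x] that algebra_seminormD(4)[OF sem[OF f(1)]] by (intro mult_mono) auto
          finally show ?thesis .
        qed
        then have "\<forall>\<^sub>F e in at_right 0. u (x * y) \<le> (u x + e) * (u y + e)"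
          by (auto simp: eventually_at_right[of 0 1] intro!: exI[of _ 1])
        moreover have "((\<lambda>e. (u x + e) * (u y + e)) \<longlongrightarrow> (u x + 0) * (u y + 0)) (at_right 0)"
          by (intro tendsto_intros)
        ultimately show ?thesis
          using tendsto_lowerbound[of "\<lambda>e. (u x + e) * (u y + e)"] by (simp add: trivial_limit_at_right_real)
      qed
      have scale: "u (c *\<^sub>C x) \<le> cmod c * u x" for c x
      proof (cases "c = 0")
        case True
        obtain f where f: "f \<in> C" using False by blast
        then show ?thesis using le[OF f, of 0] True algebra_seminorm_scaleC[OF sem[OF f], of 0 0] by simp
      next
        case c: False
        have "u (c *\<^sub>C x) / cmod c \<le> u x"
        proof (rule ge)
          fix f assume f: "f \<in> C"
          show "u (c *\<^sub>C x) / cmod c \<le> f x"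
            using le[OF f, of "c *\<^sub>C x"] algebra_seminorm_scaleC[OF sem[OF f], of c x] c
            by (simp add: field_simps)
        qed
        then show ?thesis using c by (simp add: field_simps)
      qed
      obtain f where f: "f \<in> C" using False by blast
      have "u x \<le> norm x" for x
        using le[OF f, of x] algebra_seminormD(5)[OF sem[OF f], of x] by linarith
      moreover have "1 \<le> u 1" by (intro ge algebra_seminormD(6) sem)
      ultimately have "algebra_seminorm u"
        using add mult scale nonneg by (simp add: algebra_seminorm_def)
      moreover have "u x \<le> p x" for x
        using le[OF f, of x] f CA by (force simp: A_def intro: order_trans)
      ultimately show ?thesis using le by (auto simp: A_def r_def)
    qed
  qed
  then obtain m where m: "m \<in> A" "\<And>a. a \<in> A \<Longrightarrow> r m a \<Longrightarrow> a = m" by blast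
  have "minimal_seminorm m"
    unfolding minimal_seminorm_def
  proof (intro conjI allI impI)
    show "algebra_seminorm m" using m by (simp add: A_def)
    fix q assume q: "algebra_seminorm q \<and> (\<forall>x. q x \<le> m x)"
    then have "q \<in> A" using m(1) by (auto simp: A_def intro: order_trans)
    then show "q = m" using m(2) q by (simp add: r_def)
  qed
  then show ?thesis using that m by (auto simp: A_def)
qed

text \<open>The spectral seminorm \<open>lim p(x\<^sup>n)\<^sup>1\<^sup>/\<^sup>n\<close> of \<open>p\<close> is again an algebra seminorm below \<open>p\<close>, hence equal to
  \<open>p\<close>. Written as the infimum \<open>q\<close> of the growth rates of \<open>p(x\<^sup>n)\<close>, it is subadditive by the binomial
  theorem.\<close>

lemma minimal_seminorm_spectral:
  assumes p: "minimal_seminorm p" and s: "s > 0" and C: "\<And>n. p (x ^ n) \<le> C * s ^ n"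
  shows "p x \<le> s"
proof -
  have sem: "algebra_seminorm p" using p by (simp add: minimal_seminorm_def)
  define S where "S = (\<lambda>x. {s. s > 0 \<and> (\<exists>C. \<forall>n. p (x ^ n) \<le> C * s ^ n)})"
  define q where "q = (\<lambda>x. Inf (S x))"
  have pn: "0 \<le> p x" for x by (rule algebra_seminormD(4)[OF sem])
  have p1: "p 1 \<ge> 1" by (rule algebra_seminormD(6)[OF sem])
  have Spos: "s > 0" if "s \<in> S x" for s x using that by (simp add: S_def)
  have bdd: "bdd_below (S x)" for x using Spos by (auto intro!: bdd_belowI[of _ 0] less_imp_le)
  have above: "s \<in> S x" if "s > p x" for s x
  proof -
    have "p (x ^ n) \<le> p 1 * s ^ n" for n
      using algebra_seminorm_power[OF sem, of x n] that pn[of x] p1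
      by (smt (verit) mult_left_mono power_mono)
    moreover have "s > 0" using that pn[of x] by simp
    ultimately show ?thesis by (auto simp: S_def)
  qed
  have ne: "S x \<noteq> {}" for x using above[of x "p x + 1"] by auto
  have le: "q x \<le> s" if "s \<in> S x" for s x unfolding q_def using that bdd by (rule cInf_lower)
  have ge: "b \<le> q x" if "\<And>s. s \<in> S x \<Longrightarrow> b \<le> s" for b x
    unfolding q_def using ne that by (intro cInf_greatest)
  have approx: "\<exists>s\<in>S x. s < q x + e" if "e > 0" for x e
  proof (rule ccontr)
    assume "\<not> (\<exists>s\<in>S x. s < q x + e)"
    then have "q x + e \<le> q x" by (intro ge) (auto simp: not_less)
    then show False using that by simp
  qed
  have nonneg: "0 \<le> q x" for x using Spos by (intro ge less_imp_le)
  have qp: "q x \<le> p x" for x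
  proof (rule field_le_epsilon)
    fix e :: real assume "e > 0"
    then show "q x \<le> p x + e" by (intro le above) simp
  qed
  have add: "q (x + y) \<le> q x + q y" for x y
  proof (rule field_le_epsilon)
    fix e :: real assume "e > 0"
    then obtain s t where s: "s \<in> S x" "s < q x + e/2" and t: "t \<in> S y" "t < q y + e/2"
      using approx[of "e/2"] by (meson half_gt_zero)
    obtain C E where C: "\<And>n. p (x ^ n) \<le> C * s ^ n" and E: "\<And>n. p (y ^ n) \<le> E * t ^ n"
      using s(1) t(1) by (auto simp: S_def)
    have C0: "C \<ge> 0" using C[of 0] p1 by simp
    have "p ((x + y) ^ n) \<le> (C * E) * (s + t) ^ n" for n
    proof -
      have "p ((x + y) ^ n) \<le> (\<Sum>k\<le>n. p (of_nat (n choose k) * (x ^ k * y ^ (n - k))))"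
        unfolding binomial_ring mult.assoc by (rule algebra_seminorm_sum[OF sem]) simp
      also have "\<dots> \<le> (\<Sum>k\<le>n. real (n choose k) * ((C * s ^ k) * (E * t ^ (n - k))))"
      proof (rule sum_mono)
        fix k assume "k \<in> {..n}"
        have "p (x ^ k * y ^ (n - k)) \<le> p (x ^ k) * p (y ^ (n - k))"
          by (rule algebra_seminormD(3)[OF sem])
        also have "\<dots> \<le> (C * s ^ k) * (E * t ^ (n - k))"
          using C0 Spos[OF s(1)] by (intro mult_mono C E pn) auto
        finally show "p (of_nat (n choose k) * (x ^ k * y ^ (n - k)))
            \<le> real (n choose k) * ((C * s ^ k) * (E * t ^ (n - k)))"
          by (simp add: algebra_seminorm_of_nat_mult[OF sem] mult_left_mono)
      qed
      also have "\<dots> = (C * E) * (s + t) ^ n"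
        by (simp add: binomial_ring sum_distrib_left mult_ac)
      finally show ?thesis .
    qed
    then have "s + t \<in> S (x + y)" using Spos[OF s(1)] Spos[OF t(1)] by (auto simp: S_def)
    from le[OF this] show "q (x + y) \<le> q x + q y + e" using s t by linarith
  qed
  have mult: "q (x * y) \<le> q x * q y" for x y
  proof -
    have "q (x * y) \<le> (q x + e) * (q y + e)" if "e > 0" for e
    proof -
      obtain s t where s: "s \<in> S x" "s < q x + e" and t: "t \<in> S y" "t < q y + e"
        using approx[OF \<open>e > 0\<close>, of x] approx[OF \<open>e > 0\<close>, of y] by auto
      obtain C E where C: "\<And>n. p (x ^ n) \<le> C * s ^ n" and E: "\<And>n. p (y ^ n) \<le> E * t ^ n"
        using s(1) t(1) by (auto simp: S_def)
      have C0: "C \<ge> 0" using C[of 0] p1 by simp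
      have "p ((x * y) ^ n) \<le> (C * E) * (s * t) ^ n" for n
      proof -
        have "p ((x * y) ^ n) \<le> p (x ^ n) * p (y ^ n)"
          by (simp add: power_mult_distrib algebra_seminormD(3)[OF sem])
        also have "\<dots> \<le> (C * s ^ n) * (E * t ^ n)"
          using C0 Spos[OF s(1)] by (intro mult_mono C E pn) auto
        finally show ?thesis by (simp add: power_mult_distrib mult_ac)
      qed
      then have "s * t \<in> S (x * y)" using Spos[OF s(1)] Spos[OF t(1)] by (auto simp: S_def)
      from le[OF this] show ?thesis
        using s t Spos[OF s(1)] Spos[OF t(1)] by (smt (verit) mult_mono)
    qed
    then have "\<forall>\<^sub>F e in at_right 0. q (x * y) \<le> (q x + e) * (q y + e)"
      by (auto simp: eventually_at_right[of 0 1] intro!: exI[of _ 1])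
    moreover have "((\<lambda>e. (q x + e) * (q y + e)) \<longlongrightarrow> (q x + 0) * (q y + 0)) (at_right 0)"
      by (intro tendsto_intros)
    ultimately show ?thesis
      using tendsto_lowerbound[of "\<lambda>e. (q x + e) * (q y + e)"] by (simp add: trivial_limit_at_right_real)
  qed
  have scale: "q (c *\<^sub>C x) \<le> cmod c * q x" for c x
  proof (cases "c = 0")
    case True
    then show ?thesis using qp[of 0] algebra_seminorm_scaleC[OF sem, of 0 0] by simp
  next
    case c: False
    have pow: "(c *\<^sub>C x) ^ n = c ^ n *\<^sub>C x ^ n" for n
      by (induction n) (auto simp: scaleC_mult_left scaleC_mult_right mult_ac)
    have "q (c *\<^sub>C x) / cmod c \<le> q x"
    proof (rule ge)
      fix s assume s: "s \<in> S x"
      then obtain C where C: "\<And>n. p (x ^ n) \<le> C * s ^ n" by (auto simp: S_def)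
      have "p ((c *\<^sub>C x) ^ n) \<le> C * (cmod c * s) ^ n" for n
        using mult_left_mono[OF C[of n], of "cmod c ^ n"]
        by (simp add: pow algebra_seminorm_scaleC[OF sem] norm_power power_mult_distrib mult_ac)
      then have "cmod c * s \<in> S (c *\<^sub>C x)" using Spos[OF s] c by (auto simp: S_def)
      from le[OF this] show "q (c *\<^sub>C x) / cmod c \<le> s" using c by (simp add: field_simps)
    qed
    then show ?thesis using c by (simp add: field_simps)
  qed
  have "1 \<le> q 1"
  proof (rule ge, rule ccontr)
    fix s assume s: "s \<in> S 1" "\<not> 1 \<le> s"
    then obtain C where C: "\<And>n. p (1 ^ n) \<le> C * s ^ n" by (auto simp: S_def)
    have "(\<lambda>n. C * s ^ n) \<longlonglongrightarrow> C * 0"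
      using s Spos[OF s(1)] by (intro tendsto_mult_left LIMSEQ_realpow_zero) auto
    then have "p 1 \<le> 0" using C by (intro LIMSEQ_le_const[of "\<lambda>n. C * s ^ n" 0]) auto
    then show False using p1 by simp
  qed
  then have "algebra_seminorm q"
    using add mult scale nonneg qp algebra_seminormD(5)[OF sem] unfolding algebra_seminorm_def
    by (meson order_trans)
  then have "q = p" using p qp by (simp add: minimal_seminorm_def)
  moreover have "s \<in> S x" using s C by (auto simp: S_def)
  ultimately show ?thesis using le by metis
qed

text \<open>If \<open>s\<^sup>m \<ge> p (x\<^sup>m)\<close>, division of the exponents by \<open>m\<close> with remainder shows that \<open>p (x\<^sup>n)\<close> grows at most
  like \<open>s\<^sup>n\<close>.\<close>

lemma minimal_seminorm_power:
  assumes p: "minimal_seminorm p"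
  shows "p x ^ m \<le> p (x ^ m)"
proof (cases "m = 0")
  case True
  then show ?thesis using p by (simp add: minimal_seminorm_def algebra_seminorm_def)
next
  case False
  have sem: "algebra_seminorm p" using p by (simp add: minimal_seminorm_def)
  have pn: "0 \<le> p x" for x by (rule algebra_seminormD(4)[OF sem])
  have p1: "p 1 \<ge> 1" by (rule algebra_seminormD(6)[OF sem])
  show ?thesis
  proof (rule field_le_epsilon)
    fix e :: real assume e: "e > 0"
    define s where "s = root m (p (x ^ m) + e)"
    have s: "s > 0" "s ^ m = p (x ^ m) + e"
      using False e pn[of "x ^ m"] by (auto simp: s_def real_root_pow_pos2)
    define C where "C = p 1 * (\<Sum>j<m. p (x ^ j) / s ^ j)"
    have "p (x ^ n) \<le> C * s ^ n" for n
    proof -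
      define k j where "k = n div m" and "j = n mod m"
      have n: "n = m * k + j" and j: "j < m" using False by (auto simp: k_def j_def)
      have "p (x ^ j) / s ^ j \<le> (\<Sum>j<m. p (x ^ j) / s ^ j)"
        using j s pn by (intro member_le_sum) auto
      then have xj: "p (x ^ j) \<le> (\<Sum>j<m. p (x ^ j) / s ^ j) * s ^ j" using s by (simp add: field_simps)
      have "p (x ^ n) \<le> p ((x ^ m) ^ k) * p (x ^ j)"
        unfolding n power_add power_mult by (rule algebra_seminormD(3)[OF sem])
      also have "\<dots> \<le> (p 1 * (s ^ m) ^ k) * ((\<Sum>j<m. p (x ^ j) / s ^ j) * s ^ j)"
      proof (intro mult_mono xj pn)
        have "p ((x ^ m) ^ k) \<le> p 1 * p (x ^ m) ^ k" by (rule algebra_seminorm_power[OF sem])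
        also have "\<dots> \<le> p 1 * (s ^ m) ^ k"
          using p1 pn e unfolding s(2) by (intro mult_left_mono power_mono) auto
        finally show "p ((x ^ m) ^ k) \<le> p 1 * (s ^ m) ^ k" .
        show "0 \<le> p 1 * (s ^ m) ^ k" using p1 s(1) by simp
      qed
      also have "\<dots> = C * s ^ n" by (simp add: C_def n power_add power_mult)
      finally show ?thesis .
    qed
    from minimal_seminorm_spectral[OF p s(1) this] have "p x ^ m \<le> s ^ m"
      by (intro power_mono pn)
    then show "p x ^ m \<le> p (x ^ m) + e" using s by simp
  qed
qed

text \<open>For \<open>p a > 0\<close> the decreasing limit of \<open>p (x a\<^sup>n) / p(a)\<^sup>n\<close> is an algebra seminorm below \<open>p\<close>, hence
  equal to \<open>p\<close>, so that already its second member \<open>p (x a) / p a\<close> is \<open>p x\<close>. The preceding lemma gives the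
  bound of the limit at \<open>1\<close>.\<close>

lemma minimal_seminorm_mult:
  assumes p: "minimal_seminorm p"
  shows "p (x * a) = p x * p a"
proof (cases "p a = 0")
  have sem: "algebra_seminorm p" using p by (simp add: minimal_seminorm_def)
  case True
  then show ?thesis
    using algebra_seminormD(3)[OF sem, of x a] algebra_seminormD(4)[OF sem, of "x * a"] by simp
next
  have sem: "algebra_seminorm p" using p by (simp add: minimal_seminorm_def)
  have pn: "0 \<le> p x" for x by (rule algebra_seminormD(4)[OF sem])
  case False
  define r where "r = p a"
  have r: "r > 0" using False pn[of a] by (simp add: r_def)
  define X where "X = (\<lambda>x n. p (x * a ^ n) / r ^ n)"
  define q where "q = (\<lambda>x. lim (X x))"
  have X0: "0 \<le> X x n" for x n using r pn by (simp add: X_def)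
  have dec: "decseq (X x)" for x
  proof (rule decseq_SucI)
    fix n
    have "p (x * a ^ n * a) \<le> p (x * a ^ n) * r"
      unfolding r_def by (rule algebra_seminormD(3)[OF sem])
    then have "p (x * a ^ n * a) / (r ^ n * r) \<le> p (x * a ^ n) * r / (r ^ n * r)"
      using r by (intro divide_right_mono) auto
    also have "p (x * a ^ n) * r / (r ^ n * r) = X x n" using r by (simp add: X_def)
    finally show "X x (Suc n) \<le> X x n" by (simp add: X_def mult_ac)
  qed
  have lim: "X x \<longlonglongrightarrow> q x" for x
  proof -
    obtain L where L: "X x \<longlonglongrightarrow> L"
      by (rule decseq_convergent[OF dec[of x], of 0]) (simp_all add: X0)
    then show ?thesis unfolding q_def by (simp add: limI[OF L])
  qed
  have qX: "q x \<le> X x n" for x n by (rule decseq_ge[OF dec lim])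
  have qp: "q x \<le> p x" for x using qX[of x 0] by (simp add: X_def)
  have nonneg: "0 \<le> q x" for x using X0 by (intro LIMSEQ_le_const[OF lim]) auto
  have add: "q (x + y) \<le> q x + q y" for x y
  proof (rule LIMSEQ_le[OF lim tendsto_add[OF lim lim]])
    have "X (x + y) n \<le> X x n + X y n" for n
      using r algebra_seminormD(1)[OF sem, of "x * a ^ n" "y * a ^ n"]
      by (simp add: X_def distrib_right add_divide_distrib[symmetric] divide_right_mono)
    then show "\<exists>N. \<forall>n\<ge>N. X (x + y) n \<le> X x n + X y n" by blast
  qed
  have scale: "q (c *\<^sub>C x) \<le> cmod c * q x" for c x
  proof (rule LIMSEQ_le[OF lim tendsto_mult_left[OF lim]])
    show "\<exists>N. \<forall>n\<ge>N. X (c *\<^sub>C x) n \<le> cmod c * X x n"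
      by (simp add: X_def scaleC_mult_left algebra_seminorm_scaleC[OF sem])
  qed
  have mult: "q (x * y) \<le> q x * q y" for x y
  proof (rule LIMSEQ_le[OF _ tendsto_mult[OF lim lim]])
    show "(\<lambda>n. X (x * y) (2 * n)) \<longlonglongrightarrow> q (x * y)"
      using LIMSEQ_subseq_LIMSEQ[OF lim, of "\<lambda>n. 2 * n"] by (simp add: comp_def strict_mono_def)
    have "X (x * y) (2 * n) \<le> X x n * X y n" for n
    proof -
      have "a ^ (2 * n) = a ^ n * a ^ n" by (simp add: mult_2 power_add)
      then have "x * y * a ^ (2 * n) = (x * a ^ n) * (y * a ^ n)" by (simp only: mult_ac)
      then have "p (x * y * a ^ (2 * n)) \<le> p (x * a ^ n) * p (y * a ^ n)"
        using algebra_seminormD(3)[OF sem] by metis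
      then show ?thesis using r by (simp add: X_def mult_2 power_add divide_right_mono)
    qed
    then show "\<exists>N. \<forall>n\<ge>N. X (x * y) (2 * n) \<le> X x n * X y n" by blast
  qed
  have "1 \<le> X 1 n" for n
    using minimal_seminorm_power[OF p, of a n] r by (simp add: X_def r_def)
  then have "1 \<le> q 1" by (intro LIMSEQ_le_const[OF lim]) auto
  then have "algebra_seminorm q"
    using add mult scale nonneg qp algebra_seminormD(5)[OF sem] unfolding algebra_seminorm_def
    by (meson order_trans)
  then have "q = p" using p qp by (simp add: minimal_seminorm_def)
  then have "p x * r \<le> p (x * a)"
    using qX[of x 1] r by (simp add: X_def field_simps)
  then show ?thesis using algebra_seminormD(3)[OF sem, of x a] by (simp add: r_def)
qed

text \<open>The core of the Gelfand--Mazur theorem, after Ostrowski. If \<open>p (a - \<lambda>)\<close> has the positive minimum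
  \<open>m\<close>, attained at \<open>b = a - \<lambda>\<close>, then \<open>b\<^sup>N - v\<^sup>N\<close> with \<open>N = 2\<^sup>j\<close> factors into \<open>b - v\<close> and \<open>N - 1\<close> factors
  of the form \<open>b - \<mu>\<close>, all of seminorm at least \<open>m\<close>, so \<open>p (b - v) m\<^sup>N\<^sup>-\<^sup>1 \<le> m\<^sup>N + |v|\<^sup>N\<close>. For \<open>|v| < m\<close> and
  \<open>N \<rightarrow> \<infinity>\<close> it follows that the minimum is attained at \<open>b - v\<close> as well. Such steps lead
  arbitrarily far away from \<open>a\<close>, where \<open>p (a - \<lambda>) \<ge> |\<lambda>| - p a\<close> exceeds \<open>m\<close>.\<close>

lemma minimal_seminorm_vanishes:
  assumes p: "minimal_seminorm p"
  obtains l where "p (a - l *\<^sub>C 1) = 0"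
proof -
  have sem: "algebra_seminorm p" using p by (simp add: minimal_seminorm_def)
  have pn: "0 \<le> p x" for x by (rule algebra_seminormD(4)[OF sem])
  have mult: "p (x * y) = p x * p y" for x y by (rule minimal_seminorm_mult[OF p])
  have p1: "p 1 = 1" using mult[of 1 1] algebra_seminormD(6)[OF sem] by simp
  have pc: "p (c *\<^sub>C 1) = cmod c" for c using algebra_seminorm_scaleC[OF sem, of c 1] p1 by simp
  have "continuous_on (cball 0 (2 * p a)) (\<lambda>l. p (a - l *\<^sub>C 1))"
  proof (rule continuous_onI)
    fix l e assume "e > (0::real)"
    moreover have "dist (p (a - l' *\<^sub>C 1)) (p (a - l *\<^sub>C 1)) \<le> dist l' l" for l'
      using algebra_seminorm_triangle_diff[OF sem, of "a - l' *\<^sub>C 1" "a - l *\<^sub>C 1"] pc[of "l - l'"]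
      by (simp add: dist_norm scaleC_diff_left[symmetric] norm_minus_commute)
    ultimately show "\<exists>d>0. \<forall>l'\<in>cball 0 (2 * p a).
        dist l' l < d \<longrightarrow> dist (p (a - l' *\<^sub>C 1)) (p (a - l *\<^sub>C 1)) \<le> e"
      by (meson order_trans less_imp_le)
  qed
  from continuous_attains_inf[OF compact_cball _ this]
  have "\<exists>l0. \<forall>l\<in>cball 0 (2 * p a). p (a - l0 *\<^sub>C 1) \<le> p (a - l *\<^sub>C 1)" using pn[of a] by auto
  then obtain l0 where l0: "\<And>l. l \<in> cball 0 (2 * p a) \<Longrightarrow> p (a - l0 *\<^sub>C 1) \<le> p (a - l *\<^sub>C 1)"
    by blast
  define m where "m = p (a - l0 *\<^sub>C 1)"
  have m_le: "m \<le> p (a - l *\<^sub>C 1)" for l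
  proof (cases "l \<in> cball 0 (2 * p a)")
    case False
    then have "p a \<le> p (a - l *\<^sub>C 1)"
      using algebra_seminorm_triangle_diff[OF sem, of "l *\<^sub>C 1" a] pc[of l]
        algebra_seminorm_minus[OF sem, of "a - l *\<^sub>C 1"] by simp
    then show ?thesis using l0[of 0] pn[of a] by (simp add: m_def)
  qed (simp add: m_def l0)
  have "m = 0"
  proof (rule ccontr)
    assume "m \<noteq> 0"
    then have m: "m > 0" using pn by (simp add: m_def less_le)
    have move: "p (a - (l + v) *\<^sub>C 1) = m" if l: "p (a - l *\<^sub>C 1) = m" and v: "cmod v < m" for l v
    proof -
      define b where "b = a - l *\<^sub>C 1"
      have low: "m ^ 2 ^ j \<le> p (b ^ 2 ^ j - c *\<^sub>C 1)" for j c
      proof (induction j arbitrary: c)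
        case 0
        show ?case using m_le[of "l + c"] by (simp add: b_def scaleC_add_left algebra_simps)
      next
        case (Suc j)
        define s where "s = csqrt c"
        have "b ^ 2 ^ Suc j - c *\<^sub>C 1 = (b ^ 2 ^ j - s *\<^sub>C 1) * (b ^ 2 ^ j - (- s) *\<^sub>C 1)"
        proof -
          have "c = s * s" by (simp add: s_def flip: power2_eq_square)
          then show ?thesis
            by (simp add: mult_2 power_add algebra_simps scaleC_mult_left scaleC_mult_right
                scaleC_minus_left)
        qed
        then have "p (b ^ 2 ^ Suc j - c *\<^sub>C 1) = p (b ^ 2 ^ j - s *\<^sub>C 1) * p (b ^ 2 ^ j - (- s) *\<^sub>C 1)"
          by (simp add: mult)
        moreover have "m ^ 2 ^ Suc j = m ^ 2 ^ j * m ^ 2 ^ j" by (simp add: mult_2 power_add)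
        ultimately show ?case using Suc[of s] Suc[of "- s"] m by (simp add: mult_mono pn)
      qed
      have fac: "p (b - v *\<^sub>C 1) * m ^ (2 ^ j - 1) \<le> p (b ^ 2 ^ j - v ^ 2 ^ j *\<^sub>C 1)" for j
      proof (induction j)
        case (Suc j)
        let ?B = "b ^ 2 ^ j" and ?v = "v ^ 2 ^ j"
        have "b ^ 2 ^ Suc j - v ^ 2 ^ Suc j *\<^sub>C 1 = (?B - ?v *\<^sub>C 1) * (?B - (- ?v) *\<^sub>C 1)"
          by (simp add: mult_2 power_add algebra_simps scaleC_mult_left scaleC_mult_right
                scaleC_minus_left)
        then have "p (b ^ 2 ^ Suc j - v ^ 2 ^ Suc j *\<^sub>C 1) = p (?B - ?v *\<^sub>C 1) * p (?B - (- ?v) *\<^sub>C 1)"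
          by (simp add: mult)
        moreover have "p (b - v *\<^sub>C 1) * m ^ (2 ^ j - 1) * m ^ 2 ^ j
            \<le> p (?B - ?v *\<^sub>C 1) * p (?B - (- ?v) *\<^sub>C 1)"
          using Suc low[of j "- ?v"] m pn by (intro mult_mono) auto
        moreover have "m ^ (2 ^ Suc j - 1) = m ^ (2 ^ j - 1) * m ^ 2 ^ j"
          by (simp add: power_add[symmetric] mult_2)
        ultimately show ?case by (simp add: mult.assoc)
      qed simp
      have "p (b - v *\<^sub>C 1) \<le> m * (1 + (cmod v / m) ^ 2 ^ j)" for j
      proof -
        have "p (b - v *\<^sub>C 1) * m ^ (2 ^ j - 1) \<le> p (b ^ 2 ^ j) + p (v ^ 2 ^ j *\<^sub>C 1)"
          using fac[of j] algebra_seminormD(1)[OF sem, of "b ^ 2 ^ j" "- (v ^ 2 ^ j *\<^sub>C 1)"]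
          by (simp add: algebra_seminorm_minus[OF sem])
        also have "\<dots> \<le> m ^ 2 ^ j + cmod v ^ 2 ^ j"
          using algebra_seminorm_power[OF sem, of b "2 ^ j"] l by (simp add: pc p1 norm_power b_def)
        finally have "p (b - v *\<^sub>C 1) * m ^ (2 ^ j - 1) * m \<le> (m ^ 2 ^ j + cmod v ^ 2 ^ j) * m"
          using m by (intro mult_right_mono) auto
        moreover have "m ^ (2 ^ j - 1) * m = m ^ 2 ^ j"
          by (metis power_minus_mult zero_less_numeral zero_less_power)
        ultimately have "p (b - v *\<^sub>C 1) * m ^ 2 ^ j \<le> (m ^ 2 ^ j + cmod v ^ 2 ^ j) * m"
          by (simp only: mult.assoc)
        then show ?thesis using m by (simp add: field_simps)
      qed
      moreover have "(\<lambda>j. m * (1 + (cmod v / m) ^ 2 ^ j)) \<longlonglongrightarrow> m * (1 + 0)"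
      proof (intro tendsto_intros)
        have "(\<lambda>n. (cmod v / m) ^ n) \<longlonglongrightarrow> 0" using v m by (intro LIMSEQ_realpow_zero) auto
        from LIMSEQ_subseq_LIMSEQ[OF this, of "\<lambda>j. 2 ^ j"]
        show "(\<lambda>j. (cmod v / m) ^ 2 ^ j) \<longlonglongrightarrow> 0" by (simp add: comp_def strict_mono_def)
      qed
      ultimately have "p (b - v *\<^sub>C 1) \<le> m" by (intro LIMSEQ_le_const) auto
      moreover have "b - v *\<^sub>C 1 = a - (l + v) *\<^sub>C 1" by (simp add: b_def scaleC_add_left)
      ultimately show ?thesis using m_le[of "l + v"] by simp
    qed
    have far: "p (a - (l0 + of_nat k * complex_of_real (m / 2)) *\<^sub>C 1) = m" for k
    proof (induction k)
      case (Suc k)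
      have "cmod (complex_of_real (m / 2)) < m" using m by simp
      from move[OF Suc this]
      have "p (a - (l0 + of_nat k * complex_of_real (m / 2) + complex_of_real (m / 2)) *\<^sub>C 1) = m" .
      moreover have "l0 + of_nat (Suc k) * complex_of_real (m / 2) =
          l0 + of_nat k * complex_of_real (m / 2) + complex_of_real (m / 2)"
        by (simp add: algebra_simps)
      ultimately show ?case by (simp only:)
    qed (simp add: m_def)
    obtain k :: nat where k: "real k * (m / 2) > m + p a + cmod l0"
      using reals_Archimedean3[of "m / 2"] half_gt_zero[OF m] by blast
    define c where "c = l0 + of_nat k * complex_of_real (m / 2)"
    have "real k * (m / 2) = cmod (c - l0)" using m by (simp add: c_def norm_mult)
    then have "real k * (m / 2) \<le> cmod c + cmod l0" using norm_triangle_ineq4[of c l0] by simp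
    moreover have "cmod c \<le> p a + m"
    proof -
      have "p (a - c *\<^sub>C 1) = m" unfolding c_def by (rule far)
      then show ?thesis
        using algebra_seminorm_triangle_diff[OF sem, of a "c *\<^sub>C 1"] pc[of c] by simp
    qed
    ultimately show False using k by simp
  qed
  then show ?thesis using that by (simp add: m_def)
qed

lemma character_spaceI:
  assumes "\<And>a b. h (a + b) = h a + h b" "\<And>c a. h (c *\<^sub>C a) = c * h a"
    "\<And>a b. h (a * b) = h a * h b" "h 1 = 1"
  shows "h \<in> character_space"
  using assms by (auto simp: character_space_def clinear_iff scaleC_complex_def intro!: exI[of _ 1])

text \<open>The scalar that the preceding lemma provides is unique, and this makes it a homomorphism.\<close>

lemma minimal_seminorm_is_character:
  assumes p: "minimal_seminorm p"
  obtains h where "h \<in> character_space" "\<And>a. cmod (h a) = p a"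
proof -
  have sem: "algebra_seminorm p" using p by (simp add: minimal_seminorm_def)
  have pn: "0 \<le> p x" for x by (rule algebra_seminormD(4)[OF sem])
  have mult: "p (x * y) = p x * p y" for x y by (rule minimal_seminorm_mult[OF p])
  have p1: "p 1 = 1" using mult[of 1 1] algebra_seminormD(6)[OF sem] by simp
  have pc: "p (c *\<^sub>C 1) = cmod c" for c using algebra_seminorm_scaleC[OF sem, of c 1] p1 by simp
  have zero: "p (x + y) = 0" if "p x = 0" "p y = 0" for x y
    using algebra_seminormD(1)[OF sem, of x y] pn[of "x + y"] that by simp
  have "\<forall>a. \<exists>l. p (a - l *\<^sub>C 1) = 0"
  proof
    fix a
    obtain l where "p (a - l *\<^sub>C 1) = 0" by (rule minimal_seminorm_vanishes[OF p])
    then show "\<exists>l. p (a - l *\<^sub>C 1) = 0" ..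
  qed
  then obtain h where h: "\<And>a. p (a - h a *\<^sub>C 1) = 0" by metis
  have unique: "h a = c" if "p (a - c *\<^sub>C 1) = 0" for a c
  proof -
    have "p ((a - c *\<^sub>C 1) + - (a - h a *\<^sub>C 1)) = 0"
      using that h by (intro zero) (simp_all only: algebra_seminorm_minus[OF sem])
    moreover have "(a - c *\<^sub>C 1) + - (a - h a *\<^sub>C 1) = (h a - c) *\<^sub>C 1" by (simp add: scaleC_diff_left)
    ultimately show ?thesis using pc[of "h a - c"] by simp
  qed
  have "h \<in> character_space"
  proof (rule character_spaceI)
    show "h (a + b) = h a + h b" for a b
    proof (rule unique)
      have "a + b - (h a + h b) *\<^sub>C 1 = (a - h a *\<^sub>C 1) + (b - h b *\<^sub>C 1)"
        by (simp add: scaleC_add_left)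
      then show "p (a + b - (h a + h b) *\<^sub>C 1) = 0" using zero[OF h h] by metis
    qed
    show "h (c *\<^sub>C a) = c * h a" for c a
    proof (rule unique)
      have "c *\<^sub>C a - (c * h a) *\<^sub>C 1 = c *\<^sub>C (a - h a *\<^sub>C 1)" by (simp add: scaleC_diff_right)
      then show "p (c *\<^sub>C a - (c * h a) *\<^sub>C 1) = 0" by (simp add: algebra_seminorm_scaleC[OF sem] h)
    qed
    show "h (a * b) = h a * h b" for a b
    proof (rule unique)
      have "a * b - (h a * h b) *\<^sub>C 1 = (a - h a *\<^sub>C 1) * b + h a *\<^sub>C (b - h b *\<^sub>C 1)"
        by (simp add: scaleC_diff_right left_diff_distrib scaleC_mult_left)
      moreover have "p ((a - h a *\<^sub>C 1) * b) = 0" "p (h a *\<^sub>C (b - h b *\<^sub>C 1)) = 0"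
        by (simp_all add: mult h algebra_seminorm_scaleC[OF sem])
      ultimately show "p (a * b - (h a * h b) *\<^sub>C 1) = 0" using zero by metis
    qed
    show "h 1 = 1" using pc[of 0] by (intro unique) simp
  qed
  moreover have "cmod (h a) = p a" for a
    using algebra_seminorm_triangle_diff[OF sem, of a "h a *\<^sub>C 1"] h[of a] pc[of "h a"] by simp
  ultimately show ?thesis using that by blast
qed

text \<open>Zero divisors lie in kernels of characters: the operator norm of multiplication on the
  annihilator of \<open>a\<close> is an algebra seminorm that vanishes at \<open>a\<close>.\<close>

lemma zero_divisor_character:
  fixes a :: "'a::comm_complex_banach_algebra_1"
  assumes a: "a * y0 = 0" and y0: "y0 \<noteq> 0"
  obtains h where "h \<in> character_space" "h a = 0"
proof -
  define Y where "Y = {y. a * y = 0 \<and> norm y \<le> 1}"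
  define p where "p = (\<lambda>b. SUP y\<in>Y. norm (b * y))"
  have Y0: "0 \<in> Y" by (simp add: Y_def)
  have bound: "norm (b * y) \<le> norm b" if "y \<in> Y" for b y
    using that norm_mult_ineq[of b y] mult_left_mono[of "norm y" 1 "norm b"] by (simp add: Y_def)
  then have bdd: "bdd_above ((\<lambda>y. norm (b * y)) ` Y)" for b by (auto intro!: bdd_aboveI[of _ "norm b"])
  have le: "norm (b * y) \<le> p b" if "y \<in> Y" for b y
    unfolding p_def using that bdd by (auto intro: cSUP_upper)
  have ge: "p b \<le> c" if "\<And>y. y \<in> Y \<Longrightarrow> norm (b * y) \<le> c" for b c
    unfolding p_def using Y0 that by (auto intro: cSUP_least)
  have nonneg: "0 \<le> p b" for b using le[OF Y0, of b] by simp
  have le': "norm (b * y) \<le> p b * norm y" if y: "a * y = 0" for b y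
  proof (cases "y = 0")
    case False
    let ?c = "complex_of_real (inverse (norm y))"
    have c: "cmod ?c = inverse (norm y)" by (simp add: norm_inverse)
    have "?c *\<^sub>C y \<in> Y" using False y by (simp add: Y_def norm_scaleC scaleC_mult_right norm_inverse)
    from le[OF this, of b] show ?thesis
      using False unfolding scaleC_mult_right norm_scaleC c by (simp add: field_simps)
  qed simp
  have "algebra_seminorm p" unfolding algebra_seminorm_def
  proof (intro conjI allI)
    show "p (x + y) \<le> p x + p y" for x y
    proof (rule ge)
      fix z assume "z \<in> Y"
      then show "norm ((x + y) * z) \<le> p x + p y"
        using le[of z x] le[of z y] norm_triangle_ineq[of "x * z" "y * z"] by (simp add: distrib_right)
    qed
    show "p (c *\<^sub>C x) \<le> cmod c * p x" for c x
      by (rule ge) (simp add: scaleC_mult_left norm_scaleC le mult_left_mono)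
    show "p (x * y) \<le> p x * p y" for x y
    proof (rule ge)
      fix z assume z: "z \<in> Y"
      have "a * (y * z) = y * (a * z)" by (rule mult.left_commute)
      moreover have "a * z = 0" using z by (simp add: Y_def)
      ultimately have "a * (y * z) = 0" by (simp only: mult_zero_right)
      from le'[OF this, of x] have "norm (x * y * z) \<le> p x * norm (y * z)" by (simp add: mult.assoc)
      also have "\<dots> \<le> p x * p y" using z by (intro mult_left_mono le nonneg)
      finally show "norm (x * y * z) \<le> p x * p y" .
    qed
    show "0 \<le> p x" "p x \<le> norm x" for x using nonneg bound by (auto intro: ge)
    show "1 \<le> p 1" using le'[OF a, of 1] y0 by simp
  qed
  then obtain q where q: "minimal_seminorm q" "\<And>x. q x \<le> p x" by (rule minimal_seminorm_exists) blast
  obtain h where h: "h \<in> character_space" "\<And>b. cmod (h b) = q b"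
    by (rule minimal_seminorm_is_character[OF q(1)]) blast
  have "p a \<le> 0" by (rule ge) (simp add: Y_def)
  then have "cmod (h a) \<le> 0" using q(2)[of a] h(2)[of a] by linarith
  then have "h a = 0" by simp
  with h show ?thesis using that by blast
qed

lemma character_exists: "\<exists>h. h \<in> (character_space :: ('a::comm_complex_banach_algebra_1 \<Rightarrow> complex) set)"
  by (rule zero_divisor_character[of 0 "1::'a"]) auto

lemma characterD:
  assumes "h \<in> character_space"
  shows "h (a + b) = h a + h b" "h (c *\<^sub>C a) = c * h a" "h (a * b) = h a * h b" "h 1 = 1"
    "h (a - b) = h a - h b" "h 0 = 0"
proof -
  show add: "h (a + b) = h a + h b" and scale: "h (c *\<^sub>C a) = c * h a"
    and mult: "h (a * b) = h a * h b" for a b c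
    using assms by (auto simp: character_space_def clinear_iff scaleC_complex_def)
  have "\<exists>b. h b \<noteq> 0" using assms by (simp add: character_space_def)
  then show "h 1 = 1" using mult[of 1] by auto
  show "h (a - b) = h a - h b" using add[of "a - b" b] by simp
  show "h 0 = 0" using scale[of 0 0] by simp
qed

text \<open>If \<open>|h a| > \<parallel>a\<parallel>\<close>, a scaling achieves \<open>h b = 1\<close> and \<open>\<parallel>b\<parallel> < 1\<close>; then the sum \<open>y\<close> of the powers of \<open>b\<close>
  satisfies \<open>y = b + b y\<close>, which \<open>h\<close> maps to \<open>h y = 1 + h y\<close>.\<close>

lemma character_norm_le:
  fixes a :: "'a::comm_complex_banach_algebra_1"
  assumes h: "h \<in> character_space"
  shows "cmod (h a) \<le> norm a"
proof (rule ccontr)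
  assume neg: "\<not> cmod (h a) \<le> norm a"
  then have h0: "h a \<noteq> 0" using norm_ge_zero[of a] by fastforce
  define b where "b = inverse (h a) *\<^sub>C a"
  have hb: "h b = 1" using h0 by (simp add: b_def characterD(2)[OF h])
  have b: "norm b < 1" using neg h0 by (simp add: b_def norm_scaleC norm_divide field_simps)
  have pow: "norm (b ^ Suc n) \<le> norm b ^ Suc n" for n
  proof (induction n)
    case (Suc n)
    have "norm (b ^ Suc (Suc n)) \<le> norm b * norm (b ^ Suc n)"
      using norm_mult_ineq[of b "b ^ Suc n"] by simp
    also have "\<dots> \<le> norm b * norm b ^ Suc n" by (intro mult_left_mono Suc) simp
    finally show ?case by simp
  qed simp
  have "summable (\<lambda>n. norm b ^ Suc n)" using b by (simp add: summable_mult summable_geometric)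
  then have sum: "summable (\<lambda>n. b ^ Suc n)" by (rule summable_comparison_test') (use pow in blast)
  define y where "y = (\<Sum>n. b ^ Suc n)"
  have "y = b ^ Suc 0 + (\<Sum>n. b ^ Suc (Suc n))"
    using suminf_split_head[OF sum] unfolding y_def by simp
  also have "(\<Sum>n. b ^ Suc (Suc n)) = b * y"
    using bounded_linear.suminf[OF bounded_linear_mult_right sum, of b] by (simp add: y_def)
  finally have "y = b + b * y" by simp
  then have "h y = h (b + b * y)" by (rule arg_cong)
  also have "\<dots> = h b + h b * h y" by (simp only: characterD[OF h])
  finally have "h y = h b + h b * h y" .
  then show False using hb by simp
qed

lemma character_bounded_clinear: "h \<in> character_space \<Longrightarrow> bounded_clinear h"
  by (rule bounded_clinearI[of _ 1]) (auto simp: characterD scaleC_complex_def character_norm_le)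


section \<open>Algebraic elements of semiprime algebras\<close>

definition eval_poly :: "complex poly \<Rightarrow> 'a::comm_complex_banach_algebra_1 \<Rightarrow> 'a" where
  "eval_poly p a = (\<Sum>i\<le>degree p. coeff p i *\<^sub>C a ^ i)"

lemma eval_poly_bound:
  assumes "\<And>i. i \<ge> n \<Longrightarrow> coeff p i = 0"
  shows "eval_poly p a = (\<Sum>i<n. coeff p i *\<^sub>C a ^ i)"
proof -
  have "eval_poly p a = (\<Sum>i<n + Suc (degree p). coeff p i *\<^sub>C a ^ i)"
    unfolding eval_poly_def by (intro sum.mono_neutral_left) (auto simp: coeff_eq_0)
  also have "\<dots> = (\<Sum>i<n. coeff p i *\<^sub>C a ^ i)"
    using assms by (intro sum.mono_neutral_right) auto
  finally show ?thesis .
qed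

lemma eval_poly_add: "eval_poly (p + q) a = eval_poly p a + eval_poly q a"
proof -
  let ?n = "Suc (max (degree p) (degree q))"
  have "eval_poly r a = (\<Sum>i<?n. coeff r i *\<^sub>C a ^ i)" if "degree r \<le> max (degree p) (degree q)" for r
    using that by (intro eval_poly_bound) (auto simp: coeff_eq_0)
  then show ?thesis by (simp add: degree_add_le scaleC_add_left sum.distrib)
qed

lemma eval_poly_smult: "eval_poly (smult c p) a = c *\<^sub>C eval_poly p a"
proof -
  have "eval_poly r a = (\<Sum>i<Suc (degree p). coeff r i *\<^sub>C a ^ i)" if "degree r \<le> degree p" for r
    using that by (intro eval_poly_bound) (auto simp: coeff_eq_0)
  then show ?thesis by (simp add: scaleC_sum_right scaleC_add_right)
qed

lemma eval_poly_pCons: "eval_poly (pCons c p) a = c *\<^sub>C 1 + a * eval_poly p a"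
proof -
  have "eval_poly (pCons c p) a = (\<Sum>i<Suc (Suc (degree p)). coeff (pCons c p) i *\<^sub>C a ^ i)"
    by (intro eval_poly_bound) (auto simp: coeff_pCons coeff_eq_0 split: nat.split)
  also have "\<dots> = c *\<^sub>C 1 + (\<Sum>i<Suc (degree p). coeff p i *\<^sub>C a ^ Suc i)"
    by (subst sum.lessThan_Suc_shift) simp
  also have "(\<Sum>i<Suc (degree p). coeff p i *\<^sub>C a ^ Suc i) = a * eval_poly p a"
    by (simp add: eval_poly_def lessThan_Suc_atMost sum_distrib_left scaleC_mult_right del: sum.lessThan_Suc)
  finally show ?thesis .
qed

lemma eval_poly_0: "eval_poly 0 a = 0"
  by (simp add: eval_poly_def)

lemma eval_poly_linear_mult: "eval_poly ([:- l, 1:] * q) a = (a - l *\<^sub>C 1) * eval_poly q a"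
proof -
  have "[:- l, 1:] * q = smult (- l) q + pCons 0 q" by simp
  then show ?thesis
    by (simp only: eval_poly_add eval_poly_smult eval_poly_pCons)
       (simp add: left_diff_distrib scaleC_mult_left scaleC_minus_left)
qed

lemma eval_poly_monom: "eval_poly (monom c n) a = c *\<^sub>C a ^ n"
proof -
  have "eval_poly (monom c n) a = (\<Sum>i<Suc n. coeff (monom c n) i *\<^sub>C a ^ i)"
    by (intro eval_poly_bound) auto
  also have "\<dots> = c *\<^sub>C a ^ n" by (simp add: if_distrib[where f = "\<lambda>c. c *\<^sub>C _"] cong: if_cong)
  finally show ?thesis .
qed

lemma character_eval_poly:
  assumes h: "h \<in> character_space"
  shows "h (eval_poly p a) = poly p (h a)"
  by (induction p) (auto simp: eval_poly_0 eval_poly_pCons characterD[OF h])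

text \<open>The linear combination of lower powers that represents \<open>a\<^sup>n\<close> is the value at \<open>a\<close> of a polynomial of
  degree below \<open>n\<close>.\<close>

lemma annihilating_poly_exists:
  assumes "a ^ n \<in> complex_vector.span ((\<lambda>i. a ^ i) ` {..<n})"
  obtains p where "p \<noteq> 0" "eval_poly p a = 0"
proof -
  let ?V = "{eval_poly q a | q. \<forall>i\<ge>n. coeff q i = 0}"
  have "complex_vector.subspace ?V"
  proof (rule complex_vector.subspaceI)
    show "0 \<in> ?V" by (auto intro!: exI[of _ 0] simp: eval_poly_0)
    show "x + y \<in> ?V" if xy: "x \<in> ?V" "y \<in> ?V" for x y
    proof -
      obtain p q where "x = eval_poly p a" "y = eval_poly q a"
          "\<forall>i\<ge>n. coeff p i = 0" "\<forall>i\<ge>n. coeff q i = 0"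
        using xy by blast
      then show ?thesis by (auto intro!: exI[of _ "p + q"] simp: eval_poly_add)
    qed
    show "c *\<^sub>C x \<in> ?V" if "x \<in> ?V" for c x
      using that eval_poly_smult[of c _ a, symmetric] by fastforce
  qed
  moreover have "(\<lambda>i. a ^ i) ` {..<n} \<subseteq> ?V"
  proof clarify
    fix i assume "i < n"
    then have "\<forall>j\<ge>n. coeff (monom 1 i) j = (0::complex)" by auto
    moreover have "a ^ i = eval_poly (monom 1 i) a" by (simp add: eval_poly_monom)
    ultimately show "\<exists>q. a ^ i = eval_poly q a \<and> (\<forall>j\<ge>n. coeff q j = 0)" by blast
  qed
  ultimately have "a ^ n \<in> ?V" using assms complex_vector.span_minimal by blast
  then obtain q where q: "a ^ n = eval_poly q a" "\<forall>i\<ge>n. coeff q i = 0" by blast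
  define p where "p = monom 1 n + smult (-1) q"
  have "coeff p n = 1" using q by (simp add: p_def)
  then have "p \<noteq> 0" by auto
  moreover have "eval_poly p a = 0"
    by (simp add: p_def eval_poly_add eval_poly_monom eval_poly_smult q(1)[symmetric] del: smult_minus_left)
  ultimately show ?thesis using that by blast
qed

text \<open>The principal ideal of an element of square zero has zero products.\<close>

lemma semiprime_square_eq_0:
  fixes x :: "'a::comm_complex_banach_algebra_1"
  assumes semiprime: "semiprime TYPE('a)" and x: "x * x = 0"
  shows "x = 0"
proof -
  let ?J = "range (\<lambda>b. b * x)"
  have "complex_vector.subspace ?J"
  proof (rule complex_vector.subspaceI)
    show "0 \<in> ?J" by (auto intro!: image_eqI[of _ _ 0])
    show "u + v \<in> ?J" if "u \<in> ?J" "v \<in> ?J" for u v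
      using that by (auto simp flip: distrib_right)
    show "c *\<^sub>C u \<in> ?J" if "u \<in> ?J" for c u
      using that by (auto simp flip: scaleC_mult_left)
  qed
  moreover have "\<forall>b. \<forall>u\<in>?J. b * u \<in> ?J" by (auto simp flip: mult.assoc)
  moreover have "u * v = 0" if uv: "u \<in> ?J" "v \<in> ?J" for u v
  proof -
    obtain b c where "u = b * x" "v = c * x" using uv by blast
    then have "u * v = (b * c) * (x * x)" by (simp only: mult_ac)
    then show ?thesis using x by simp
  qed
  ultimately have "?J = {0}"
    using semiprime unfolding semiprime_def algebra_ideal_def by blast
  moreover have "x \<in> ?J" by (auto intro!: image_eqI[of _ _ 1])
  ultimately show ?thesis by blast
qed

lemma semiprime_power_eq_0:
  fixes x :: "'a::comm_complex_banach_algebra_1"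
  assumes semiprime: "semiprime TYPE('a)" and x: "x ^ n = 0"
  shows "x = 0"
  using x
proof (induction n)
  case (Suc n)
  show ?case
  proof (cases "n = 0")
    case True
    then show ?thesis using Suc.prems by simp
  next
    case False
    then have "n + n = Suc n + (n - 1)" by simp
    then have "x ^ n * x ^ n = x ^ Suc n * x ^ (n - 1)" by (simp only: power_add[symmetric])
    then have "x ^ n * x ^ n = 0" by (simp only: Suc.prems mult_zero_left)
    then have "x ^ n = 0" by (rule semiprime_square_eq_0[OF semiprime])
    then show ?thesis by (rule Suc.IH)
  qed
qed simp

lemma finite_range_on_characters_constant:
  fixes a :: "'a::comm_complex_banach_algebra_1"
  assumes connected: "connected_space (gelfand_topology :: ('a \<Rightarrow> complex) topology)"
    and S: "finite S" "\<And>h. h \<in> character_space \<Longrightarrow> h a \<in> S"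
  obtains l where "\<And>h. h \<in> character_space \<Longrightarrow> h a = l"
proof -
  let ?X = "gelfand_topology :: ('a \<Rightarrow> complex) topology"
  have top: "topspace ?X = character_space" by (simp add: gelfand_topology_def)
  have "continuous_map ?X euclidean (\<lambda>h. h a)"
    unfolding gelfand_topology_def
    by (intro continuous_map_from_subtopology continuous_map_product_projection) simp
  then have "connectedin euclidean ((\<lambda>h. h a) ` topspace ?X)"
    by (rule connectedin_continuous_map_image) (simp add: connectedin_topspace connected)
  then have "connected ((\<lambda>h. h a) ` (character_space :: ('a \<Rightarrow> complex) set))"
    by (simp add: top)
  moreover have "finite ((\<lambda>h. h a) ` (character_space :: ('a \<Rightarrow> complex) set))"
    by (rule finite_subset[OF _ S(1)]) (use S(2) in auto)
  ultimately have "(\<lambda>h. h a) ` (character_space :: ('a \<Rightarrow> complex) set) = {} \<or>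
      (\<exists>l. (\<lambda>h. h a) ` (character_space :: ('a \<Rightarrow> complex) set) = {l})"
    by (simp add: connected_finite_iff_sing)
  then show ?thesis using that by auto
qed

text \<open>Every root \<open>\<alpha>\<close> of the minimal polynomial of \<open>a\<close> makes \<open>a - \<alpha>\<close> a zero divisor, so \<open>\<alpha>\<close> is the value of
  a character at \<open>a\<close>. These values are roots, finitely many, so by connectedness there is only one
  root. It is simple because there are no nilpotents.\<close>

lemma algebraic_element_scalar:
  fixes a :: "'a::comm_complex_banach_algebra_1"
  assumes semiprime: "semiprime TYPE('a)"
    and connected: "connected_space (gelfand_topology :: ('a \<Rightarrow> complex) topology)"
    and p: "p \<noteq> 0" "eval_poly p a = 0"
  shows "\<exists>l. a = l *\<^sub>C 1"
proof -
  define m where "m = (ARG_MIN degree p. p \<noteq> 0 \<and> eval_poly p a = 0)"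
  have m: "m \<noteq> 0" "eval_poly m a = 0"
    using arg_min_natI[of "\<lambda>p. p \<noteq> 0 \<and> eval_poly p a = 0" p degree] p unfolding m_def by auto
  have min: "eval_poly q a \<noteq> 0" if "q \<noteq> 0" "degree q < degree m" for q
    using arg_min_nat_le[of "\<lambda>p. p \<noteq> 0 \<and> eval_poly p a = 0" q degree] that unfolding m_def by auto
  have "\<exists>l. \<forall>h\<in>character_space. h a = l"
  proof -
    have "h a \<in> {z. poly m z = 0}" if "h \<in> character_space" for h
      using character_eval_poly[OF that, of m a] m(2) characterD(6)[OF that] by simp
    then show ?thesis
      using finite_range_on_characters_constant[OF connected poly_roots_finite[OF m(1)], of a] by metis
  qed
  then obtain l where l: "\<And>h. h \<in> character_space \<Longrightarrow> h a = l" by blast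
  have factor: "\<exists>q. m = [:- z, 1:] * q \<and> q \<noteq> 0 \<and> degree q < degree m" if z: "poly m z = 0" for z
  proof -
    obtain q where q: "m = [:- z, 1:] * q" using z unfolding poly_eq_0_iff_dvd dvd_def by blast
    moreover have "q \<noteq> 0" using q m(1) by auto
    moreover have "degree m = Suc (degree q)"
      unfolding q by (subst degree_mult_eq) (use \<open>q \<noteq> 0\<close> in auto)
    ultimately show ?thesis by auto
  qed
  have root: "z = l" if z: "poly m z = 0" for z
  proof -
    obtain q where q: "m = [:- z, 1:] * q" "q \<noteq> 0" "degree q < degree m" using factor[OF z] by blast
    have "(a - z *\<^sub>C 1) * eval_poly q a = 0" using m(2) unfolding q(1) eval_poly_linear_mult .
    then obtain h where h: "h \<in> character_space" "h (a - z *\<^sub>C 1) = 0"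
      using zero_divisor_character min[OF q(2,3)] by blast
    then show ?thesis using l[OF h(1)] by (simp add: characterD[OF h(1)])
  qed
  have "degree m \<noteq> 0"
  proof
    assume "degree m = 0"
    then obtain c where c: "m = [:c:]" by (meson degree_eq_zeroE)
    then have "c *\<^sub>C (1::'a) = 0" using m(2) by (simp add: eval_poly_pCons eval_poly_0)
    then have "norm (c *\<^sub>C (1::'a)) = 0" by simp
    then show False using m(1) c by (simp add: norm_scaleC)
  qed
  then obtain z where "poly m z = 0"
    using fundamental_theorem_of_algebra[of m] by (auto simp: constant_degree)
  then have "poly m l = 0" using root by blast
  then obtain q where q: "m = [:- l, 1:] * q" "q \<noteq> 0" "degree q < degree m" using factor by blast
  have zero: "(a - l *\<^sub>C 1) * eval_poly q a = 0" using m(2) unfolding q(1) eval_poly_linear_mult .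
  have "degree q = 0"
  proof (rule ccontr)
    assume "degree q \<noteq> 0"
    then obtain z where z: "poly q z = 0"
      using fundamental_theorem_of_algebra[of q] by (auto simp: constant_degree)
    then have "z = l" by (intro root) (simp add: q(1))
    then obtain r where r: "q = [:- l, 1:] * r" using z unfolding poly_eq_0_iff_dvd dvd_def by blast
    \<comment> \<open>A double root \<open>l\<close> makes the nonzero element \<open>q(a)\<close> square to zero.\<close>
    have "eval_poly q a = (a - l *\<^sub>C 1) * eval_poly r a" unfolding r by (rule eval_poly_linear_mult)
    then have "eval_poly q a * eval_poly q a = (a - l *\<^sub>C 1) * eval_poly q a * eval_poly r a"
      by (metis mult.assoc mult.commute)
    then have "eval_poly q a * eval_poly q a = 0" by (simp only: zero mult_zero_left)
    then have "eval_poly q a = 0" by (rule semiprime_square_eq_0[OF semiprime])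
    then show False using min[OF q(2,3)] by simp
  qed
  then obtain c where c: "q = [:c:]" by (meson degree_eq_zeroE)
  then have "c \<noteq> 0" "c *\<^sub>C (a - l *\<^sub>C 1) = 0"
    using zero q(2) by (auto simp: eval_poly_pCons eval_poly_0 scaleC_mult_right)
  then have "inverse c *\<^sub>C c *\<^sub>C (a - l *\<^sub>C 1) = 0" by simp
  then have "a = l *\<^sub>C 1" using \<open>c \<noteq> 0\<close> by simp
  then show ?thesis ..
qed


section \<open>Quasicompact operators\<close>

lemma compact_operator_subsequence:
  fixes x :: "nat \<Rightarrow> 'a::complex_banach_space"
  assumes K: "compact_operator K" and x: "bounded (range x)"
  obtains r :: "nat \<Rightarrow> nat" and l where "strict_mono r" "(\<lambda>n. K (x (r n))) \<longlonglongrightarrow> l"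
proof -
  have lin: "bounded_clinear K" and comp: "compact (closure (K ` cball 0 1))"
    using K by (simp_all add: compact_operator_def)
  obtain B where B: "B > 0" "\<And>n. norm (x n) \<le> B" using x by (auto simp: bounded_pos)
  define c where "c = complex_of_real (inverse B)"
  have c: "cmod c = inverse B" using B(1) by (simp add: c_def norm_inverse)
  have "norm (c *\<^sub>C x n) \<le> 1" for n using B(1) B(2)[of n] by (simp add: norm_scaleC c field_simps)
  then have "K (c *\<^sub>C x n) \<in> closure (K ` cball 0 1)" for n by (auto intro!: closure_subset[THEN subsetD])
  then obtain l r where r: "strict_mono r" "((\<lambda>n. K (c *\<^sub>C x n)) \<circ> r) \<longlonglongrightarrow> l"
    using comp unfolding compact_def by meson
  have "(\<lambda>n. inverse c *\<^sub>C K (c *\<^sub>C x (r n))) \<longlonglongrightarrow> inverse c *\<^sub>C l"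
    using r(2) bounded_clinear_tendsto[OF bounded_clinear_of_scaleC[OF bounded_clinear_ident]]
    by (simp add: comp_def)
  moreover have "inverse c *\<^sub>C K (c *\<^sub>C x (r n)) = K (x (r n))" for n
  proof -
    have "c \<noteq> 0" using B(1) by (simp add: c_def)
    then show ?thesis by (simp add: bounded_clinear_scaleC[OF lin])
  qed
  ultimately show ?thesis using that r(1) by simp
qed

lemma compact_operator_functional_scaleC:
  assumes h: "bounded_clinear (h :: 'a::complex_banach_space \<Rightarrow> complex)"
  shows "compact_operator (\<lambda>x. h x *\<^sub>C v)"
proof -
  obtain M where M: "M > 0" "\<And>x. norm (h x) \<le> M * norm x" using bounded_clinear_bound[OF h] by blast
  let ?C = "(\<lambda>a. a *\<^sub>C v) ` cball 0 M"
  have "compact ?C"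
    by (intro compact_continuous_image linear_continuous_on bounded_clinear_linear
        bounded_clinear_functional_scaleC bounded_clinear_ident compact_cball)
  moreover have "(\<lambda>x. h x *\<^sub>C v) ` cball 0 1 \<subseteq> ?C"
  proof clarify
    fix x :: 'a assume "x \<in> cball 0 1"
    then have "M * norm x \<le> M * 1" using M(1) by (intro mult_left_mono) auto
    then have "norm (h x) \<le> M" using M(2)[of x] by simp
    then show "h x *\<^sub>C v \<in> ?C" by auto
  qed
  ultimately have "compact (closure ((\<lambda>x. h x *\<^sub>C v) ` cball 0 1))"
    by (metis closure_minimal compact_Int_closed closed_closure compact_imp_closed inf.absorb_iff2)
  then show ?thesis by (simp add: compact_operator_def bounded_clinear_functional_scaleC[OF h])
qed

text \<open>With \<open>c = 1/z\<close>, the operator \<open>T - c\<close> has a left inverse \<open>S\<close> modulo a compact operator \<open>K\<close>: from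
  \<open>x = S (T - c) x - K x\<close>, where the first summand converges along with \<open>(T - c) x\<close>, compactness of
  \<open>K\<close> yields a convergent subsequence.\<close>

lemma quasicompact_proper:
  fixes T :: "'a::complex_banach_space \<Rightarrow> 'a"
  assumes T: "quasicompact T" and z: "cmod z \<le> 1"
  shows "proper_on_bounded (\<lambda>x. x - z *\<^sub>C T x)"
  unfolding proper_on_bounded_def
proof (intro allI impI)
  fix x :: "nat \<Rightarrow> 'a"
  assume x: "bounded (range x) \<and> convergent (\<lambda>n. x n - z *\<^sub>C T (x n))"
  then obtain y where y: "(\<lambda>n. x n - z *\<^sub>C T (x n)) \<longlonglongrightarrow> y" by (auto simp: convergent_def)
  have lin: "bounded_clinear T" using T by (simp add: quasicompact_def)
  consider (finite) S :: "'a set" where "finite S" "complex_vector.span S = UNIV"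
    | (zero) "z = 0"
    | (ess) "z \<noteq> 0" "essential_spectral_radius T < 1"
    using T by (auto simp: quasicompact_def)
  then show "\<exists>r::nat \<Rightarrow> nat. strict_mono r \<and> convergent (x \<circ> r)"
  proof cases
    case finite
    then have "locally_sequentially_compact (UNIV :: 'a set)"
      using locally_sequentially_compact_span by metis
    then show ?thesis
      using locally_sequentially_compactD[of UNIV x] x unfolding convergent_def by (metis UNIV_I)
  next
    case zero
    then show ?thesis using x by (intro exI[of _ id]) (simp add: strict_mono_def comp_def)
  next
    case ess
    define c where "c = inverse z"
    have "cmod c = inverse (cmod z)" by (simp add: c_def norm_inverse)
    then have "cmod c \<ge> 1" using z ess(1) by (simp add: one_le_inverse_iff)
    have "c \<notin> essential_spectrum T"
    proof
      assume "c \<in> essential_spectrum T"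
      then have "ennreal (cmod c) \<le> essential_spectral_radius T"
        unfolding essential_spectral_radius_def by (rule SUP_upper)
      moreover have "1 \<le> ennreal (cmod c)" using \<open>cmod c \<ge> 1\<close> by simp
      ultimately show False using ess(2) by (metis leD order_trans)
    qed
    then obtain S where S: "bounded_clinear S" "compact_operator (\<lambda>x. S (T x - c *\<^sub>C x) - x)"
      by (auto simp: essential_spectrum_def calkin_invertible_def)
    have Ty: "T (x n) - c *\<^sub>C x n = (- c) *\<^sub>C (x n - z *\<^sub>C T (x n))" for n
      using ess(1) by (simp add: c_def scaleC_diff_right scaleC_minus_left)
    obtain r :: "nat \<Rightarrow> nat" and l where r: "strict_mono r"
        "(\<lambda>n. S (T (x (r n)) - c *\<^sub>C x (r n)) - x (r n)) \<longlonglongrightarrow> l"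
      using compact_operator_subsequence[OF S(2), of x] x by blast
    have "(\<lambda>n. x (r n) - z *\<^sub>C T (x (r n))) \<longlonglongrightarrow> y"
      using LIMSEQ_subseq_LIMSEQ[OF y r(1)] by (simp add: comp_def)
    then have "(\<lambda>n. S (T (x (r n)) - c *\<^sub>C x (r n))) \<longlonglongrightarrow> S ((- c) *\<^sub>C y)"
      unfolding Ty
      by (intro bounded_clinear_tendsto[OF S(1)]
          bounded_clinear_tendsto[OF bounded_clinear_of_scaleC[OF bounded_clinear_ident]])
    from tendsto_diff[OF this r(2)] have "(x \<circ> r) \<longlonglongrightarrow> S ((- c) *\<^sub>C y) - l"
      by (simp add: comp_def)
    then show ?thesis using r(1) by (auto simp: convergent_def)
  qed
qed

lemma proper_on_bounded_rank_one_perturbation: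
  fixes A :: "'a::complex_banach_space \<Rightarrow> 'b::complex_banach_space"
  assumes A: "proper_on_bounded A" and h: "bounded_clinear (h :: 'a \<Rightarrow> complex)"
  shows "proper_on_bounded (\<lambda>x. A x + h x *\<^sub>C v)"
  unfolding proper_on_bounded_def
proof (intro allI impI)
  fix x :: "nat \<Rightarrow> 'a"
  assume x: "bounded (range x) \<and> convergent (\<lambda>n. A (x n) + h (x n) *\<^sub>C v)"
  then obtain y where y: "(\<lambda>n. A (x n) + h (x n) *\<^sub>C v) \<longlonglongrightarrow> y" by (auto simp: convergent_def)
  obtain s :: "nat \<Rightarrow> nat" and l where s: "strict_mono s" "(\<lambda>n. h (x (s n)) *\<^sub>C v) \<longlonglongrightarrow> l"
    using compact_operator_subsequence[OF compact_operator_functional_scaleC[OF h], of x] x by blast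
  have "(\<lambda>n. A (x (s n)) + h (x (s n)) *\<^sub>C v) \<longlonglongrightarrow> y"
    using LIMSEQ_subseq_LIMSEQ[OF y s(1)] by (simp add: comp_def)
  from tendsto_diff[OF this s(2)] have Ax: "(\<lambda>n. A (x (s n))) \<longlonglongrightarrow> y - l" by simp
  have "bounded (range (\<lambda>n. x (s n)))"
    using x by (auto intro: bounded_subset)
  from proper_on_boundedD[OF A this Ax]
  obtain r :: "nat \<Rightarrow> nat" and k where r: "strict_mono r" "((\<lambda>n. x (s n)) \<circ> r) \<longlonglongrightarrow> k" by blast
  have "strict_mono (s \<circ> r)" by (rule strict_mono_o[OF s(1) r(1)])
  moreover have "convergent (x \<circ> (s \<circ> r))" using r(2) by (auto simp: convergent_def comp_def)
  ultimately show "\<exists>r::nat \<Rightarrow> nat. strict_mono r \<and> convergent (x \<circ> r)" by blast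
qed

text \<open>Here \<open>T\<^sup>m - c\<^sup>m\<close> is an operator of rank one minus an invertible operator \<open>A\<close>, and it factors as
  \<open>(T - c) U\<close>. As the hypotheses on \<open>h\<close> and \<open>e\<close> make \<open>A\<close> commute with \<open>T\<close>, the operator \<open>- A\<^sup>-\<^sup>1 U\<close> inverts
  \<open>T - c\<close> from both sides modulo rank one.\<close>

lemma calkin_invertible_if_power_near_rank_one:
  fixes T :: "'a::complex_banach_space \<Rightarrow> 'a"
  assumes T: "bounded_clinear T" and h: "bounded_clinear (h :: 'a \<Rightarrow> complex)"
    and hT: "\<And>x. h (T x) = h x" and Te: "T e = e"
    and near: "\<And>x. norm ((T ^^ m) x - h x *\<^sub>C e) \<le> q * norm x" and q: "0 \<le> q" "q < cmod c ^ m"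
  shows "calkin_invertible (\<lambda>x. T x - c *\<^sub>C x)"
proof -
  let ?E = "\<lambda>x. (T ^^ m) x - h x *\<^sub>C e"
  define A where "A = (\<lambda>x. c ^ m *\<^sub>C x + (- 1) *\<^sub>C ?E x)"
  have linE: "bounded_clinear ?E"
    by (intro bounded_clinear_minus_op bounded_clinear_funpow T bounded_clinear_functional_scaleC h)
  have linA: "bounded_clinear A" unfolding A_def
    by (intro bounded_clinear_plus bounded_clinear_of_scaleC linE bounded_clinear_ident)
  have small: "norm ((- 1) *\<^sub>C ?E x) \<le> q * norm x" for x
    using near[of x] by (simp only: norm_scaleC norm_minus_cancel norm_one mult_1)
  have "cmod (c ^ m) \<noteq> 0" using q unfolding norm_power by linarith
  then have cm: "c ^ m \<noteq> 0" by (simp only: norm_eq_zero not_False_eq_True)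
  have "surj A" unfolding A_def
  proof (rule bounded_below_surj_perturb[where d = "cmod c ^ m" and q = q])
    show "surj (\<lambda>x. c ^ m *\<^sub>C x :: 'a)"
      by (rule surjI[of _ "\<lambda>x. inverse (c ^ m) *\<^sub>C x"]) (use cm in simp)
    show "norm ((- 1) *\<^sub>C ?E x) \<le> q * norm x" for x by (rule small)
    show "bounded_clinear (\<lambda>x. c ^ m *\<^sub>C x :: 'a)"
      by (intro bounded_clinear_of_scaleC bounded_clinear_ident)
    show "bounded_clinear (\<lambda>x. (- 1) *\<^sub>C ?E x)" by (intro bounded_clinear_of_scaleC linE)
  qed (use q in \<open>auto simp: norm_scaleC norm_power\<close>)
  moreover have below: "(cmod c ^ m - q) * norm x \<le> norm (A x)" for x
  proof -
    have "cmod c ^ m * norm x = norm (A x - (- 1) *\<^sub>C ?E x)"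
      by (simp only: A_def add_diff_cancel_right' norm_scaleC norm_power)
    then have "cmod c ^ m * norm x \<le> norm (A x) + q * norm x"
      using norm_triangle_ineq4[of "A x" "(- 1) *\<^sub>C ?E x"] small[of x] by linarith
    then show ?thesis by (simp add: left_diff_distrib)
  qed
  define S where "S = inv A"
  have d: "cmod c ^ m - q > 0" using q by simp
  have S: "bounded_clinear S" "\<And>x. S (A x) = x" "\<And>x. A (S x) = x"
    unfolding S_def using bounded_clinear_inv[OF linA d below \<open>surj A\<close>] by auto
  have "A (T x) = T (A x)" for x
    by (simp add: A_def bounded_clinear_simps[OF T] hT Te funpow_swap1 scaleC_minus_left)
  then have ST: "S (T x) = T (S x)" for x using S(2,3) by metis
  define U where "U = (\<lambda>x. \<Sum>j<m. c ^ (m - Suc j) *\<^sub>C (T ^^ j) x)"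
  have linU: "bounded_clinear U" unfolding U_def
    by (intro bounded_clinear_sum_op bounded_clinear_of_scaleC bounded_clinear_funpow T)
  have factor: "T (U x) - c *\<^sub>C U x = h x *\<^sub>C e - A x" for x
  proof -
    let ?g = "\<lambda>j. c ^ (m - j) *\<^sub>C (T ^^ j) x"
    have "T (U x) - c *\<^sub>C U x =
        (\<Sum>j<m. c ^ (m - Suc j) *\<^sub>C (T ^^ Suc j) x - (c * c ^ (m - Suc j)) *\<^sub>C (T ^^ j) x)"
      by (simp add: U_def bounded_clinear_simps[OF T] scaleC_sum_right sum_subtractf)
    also have "\<dots> = (\<Sum>j<m. ?g (Suc j) - ?g j)"
    proof (intro sum.cong refl)
      fix j assume "j \<in> {..<m}"
      then have "c * c ^ (m - Suc j) = c ^ (m - j)" by (simp add: Suc_diff_Suc flip: power_Suc)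
      then show "c ^ (m - Suc j) *\<^sub>C (T ^^ Suc j) x - (c * c ^ (m - Suc j)) *\<^sub>C (T ^^ j) x = ?g (Suc j) - ?g j"
        by simp
    qed
    also have "\<dots> = (T ^^ m) x - c ^ m *\<^sub>C x" by (subst sum_lessThan_telescope) simp
    also have "\<dots> = h x *\<^sub>C e - A x" by (simp add: A_def scaleC_minus_left)
    finally show ?thesis .
  qed
  have TkT: "(T ^^ j) (T x) = T ((T ^^ j) x)" for j x by (simp add: funpow_swap1)
  have UT: "U (T x) = T (U x)" for x by (simp add: U_def bounded_clinear_simps[OF T] TkT)
  let ?V = "\<lambda>x. (- 1) *\<^sub>C S (U x)"
  have "compact_operator (\<lambda>x. h x *\<^sub>C ((- 1) *\<^sub>C S e))"
    by (rule compact_operator_functional_scaleC[OF h])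
  moreover have "?V (T x - c *\<^sub>C x) - x = h x *\<^sub>C ((- 1) *\<^sub>C S e)" for x
  proof -
    have "U (T x - c *\<^sub>C x) = h x *\<^sub>C e - A x"
      using factor[of x] by (simp add: bounded_clinear_simps[OF linU] UT)
    then show ?thesis by (simp add: bounded_clinear_simps[OF S(1)] S(2) scaleC_minus_left scaleC_diff_right)
  qed
  moreover have "T (?V x) - c *\<^sub>C ?V x - x = h x *\<^sub>C ((- 1) *\<^sub>C S e)" for x
  proof -
    have "T (?V x) - c *\<^sub>C ?V x = (- 1) *\<^sub>C S (T (U x) - c *\<^sub>C U x)"
      by (simp add: bounded_clinear_simps[OF T] bounded_clinear_simps[OF S(1)] ST
          scaleC_diff_right scaleC_minus_left mult.commute)
    then show ?thesis
      unfolding factor by (simp add: bounded_clinear_simps[OF S(1)] S(2) scaleC_minus_left scaleC_diff_right)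
  qed
  moreover have "bounded_clinear ?V"
    by (intro bounded_clinear_of_scaleC bounded_clinear_compose[OF S(1) linU])
  ultimately show ?thesis unfolding calkin_invertible_def by (intro exI[of _ ?V]) simp
qed

lemma onorm_le_pointwise:
  assumes "bounded_clinear f"
  shows "norm (f x) \<le> onorm f * norm x"
  by (rule onorm[OF bounded_clinear_linear[OF assms]])

lemma converges_in_operator_norm_pointwise:
  assumes F: "converges_in_operator_norm F P"
  shows "(\<lambda>n. F n x) \<longlonglongrightarrow> P x"
proof -
  have "(\<lambda>n. onorm (\<lambda>x. F n x - P x) * norm x) \<longlonglongrightarrow> 0"
    using F by (intro tendsto_mult_left_zero) (simp add: converges_in_operator_norm_def)
  moreover have le: "norm (F n x - P x) \<le> onorm (\<lambda>x. F n x - P x) * norm x" for n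
    using F onorm_le_pointwise[OF bounded_clinear_minus_op[of "F n" P], of x]
    by (simp add: converges_in_operator_norm_def)
  ultimately have "(\<lambda>n. F n x - P x) \<longlonglongrightarrow> 0"
    by (intro Lim_null_comparison[OF always_eventually[OF allI[OF le]]])
  then show ?thesis by (simp add: LIM_zero_iff)
qed

lemma rank_one_unital_endomorphism:
  assumes P: "rank_one P" "unital_endomorphism P"
  obtains h where "h \<in> character_space" "P = (\<lambda>b. h b *\<^sub>C 1)"
proof -
  have lin: "P (x + y) = P x + P y" "P (c *\<^sub>C x) = c *\<^sub>C P x" "P (x * y) = P x * P y" "P 1 = 1" for x y c
    using P(2) by (auto simp: unital_endomorphism_def clinear_iff)
  obtain B where B: "B \<subseteq> range P" "complex_vector.independent B" "range P \<subseteq> complex_vector.span B"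
      "card B = complex_vector.dim (range P)"
    by (rule complex_vector.basis_exists)
  then obtain b where b: "B = {b}" using P(1) by (auto simp: rank_one_def card_1_singleton_iff)
  have span: "\<exists>c. P x = c *\<^sub>C b" for x
    using B(3) b complex_vector.span_singleton[of b] by auto
  then obtain g where g: "\<And>x. P x = g x *\<^sub>C b" by metis
  have g1: "1 = g 1 *\<^sub>C b" using g[of 1] lin(4) by simp
  then have "g 1 \<noteq> 0" by auto
  then have b1: "b = inverse (g 1) *\<^sub>C 1" by (subst g1) simp
  define h where "h = (\<lambda>x. g x * inverse (g 1))"
  have h: "P x = h x *\<^sub>C 1" for x unfolding g h_def by (subst b1) simp
  have "h \<in> character_space"
  proof (rule character_spaceI; rule scaleC_one_inject[THEN iffD1])
    show "h (x + y) *\<^sub>C (1::'a) = (h x + h y) *\<^sub>C 1" for x y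
      by (simp only: h[symmetric] lin scaleC_add_left)
    show "h (c *\<^sub>C x) *\<^sub>C (1::'a) = (c * h x) *\<^sub>C 1" for c x
      by (simp only: h[symmetric] lin scaleC_scaleC[symmetric])
    show "h (x * y) *\<^sub>C (1::'a) = (h x * h y) *\<^sub>C 1" for x y
      using lin(3)[of x y] by (simp add: h scaleC_mult_left scaleC_mult_right)
    show "h 1 *\<^sub>C (1::'a) = 1 *\<^sub>C 1" by (simp only: h[symmetric] lin) simp
  qed
  then show ?thesis using that h by blast
qed

lemma rank_one_functional_scaleC:
  fixes v :: "'b::complex_banach_space"
  assumes "h x = (1::complex)" "v \<noteq> 0" and scale: "\<And>c. h (c *\<^sub>C x) = c * h x"
  shows "rank_one (\<lambda>x. h x *\<^sub>C v)"
proof -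
  have "range (\<lambda>x. h x *\<^sub>C v) = complex_vector.span {v}"
  proof
    show "range (\<lambda>x. h x *\<^sub>C v) \<subseteq> complex_vector.span {v}"
      by (auto simp: complex_vector.span_singleton)
    show "complex_vector.span {v} \<subseteq> range (\<lambda>x. h x *\<^sub>C v)"
    proof
      fix u assume "u \<in> complex_vector.span {v}"
      then obtain c where "u = c *\<^sub>C v" by (auto simp: complex_vector.span_singleton)
      then have "u = h (c *\<^sub>C x) *\<^sub>C v" using assms by simp
      then show "u \<in> range (\<lambda>x. h x *\<^sub>C v)" by blast
    qed
  qed
  moreover have "complex_vector.dim (complex_vector.span {v}) = 1"
    using assms(2) by (subst complex_vector.dim_span_eq_card_independent)
      (auto simp: complex_vector.dependent_def)
  ultimately show ?thesis by (simp add: rank_one_def)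
qed

lemma quasicompact_if_powers_converge:
  fixes T :: "'a::comm_complex_banach_algebra_1 \<Rightarrow> 'a"
  assumes T: "bounded_clinear T" "unital_endomorphism T"
    and P: "rank_one P" "unital_endomorphism P" "converges_in_operator_norm (\<lambda>n. T ^^ n) P"
  shows "quasicompact T"
proof -
  obtain h where h: "h \<in> character_space" "P = (\<lambda>b. h b *\<^sub>C 1)"
    by (rule rank_one_unital_endomorphism[OF P(1,2)])
  have linP: "bounded_clinear P" using P(3) by (simp add: converges_in_operator_norm_def)
  have PT: "P (T x) = P x" for x
  proof -
    have "(\<lambda>n. (T ^^ Suc n) x) \<longlonglongrightarrow> P x"
      using LIMSEQ_Suc[OF converges_in_operator_norm_pointwise[OF P(3)]] .
    moreover have "(T ^^ Suc n) x = (T ^^ n) (T x)" for n by (simp add: funpow_swap1)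
    ultimately have "(\<lambda>n. (T ^^ n) (T x)) \<longlonglongrightarrow> P x" by (simp only:)
    with converges_in_operator_norm_pointwise[OF P(3), of "T x"] show ?thesis by (rule LIMSEQ_unique)
  qed
  have hT: "h (T x) = h x" for x using PT[of x] by (simp add: h(2) scaleC_one_inject)
  have "(\<lambda>n. onorm (\<lambda>x. (T ^^ n) x - P x)) \<longlonglongrightarrow> 0"
    using P(3) by (simp add: converges_in_operator_norm_def)
  then have "\<forall>\<^sub>F n in sequentially. onorm (\<lambda>x. (T ^^ n) x - P x) < 1/2"
    by (rule order_tendstoD) simp
  then have "\<forall>\<^sub>F n in sequentially. onorm (\<lambda>x. (T ^^ n) x - P x) < 1/2 \<and> n > 0"
    using eventually_gt_at_top by (rule eventually_conj)
  then obtain m where m: "onorm (\<lambda>x. (T ^^ m) x - P x) < 1/2" "m > 0"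
    by (auto dest: eventually_happens)
  have near: "norm ((T ^^ m) x - h x *\<^sub>C 1) \<le> 1/2 * norm x" for x
  proof -
    have "norm ((T ^^ m) x - P x) \<le> onorm (\<lambda>x. (T ^^ m) x - P x) * norm x"
      by (rule onorm_le_pointwise[OF bounded_clinear_minus_op[OF bounded_clinear_funpow[OF T(1)] linP]])
    also have "\<dots> \<le> 1/2 * norm x" using m by (intro mult_right_mono) auto
    finally show ?thesis by (simp add: h(2))
  qed
  define r where "r = root m (1/2)"
  have r: "0 \<le> r" "r < 1" "r ^ m = 1/2"
    using m(2) by (auto simp: r_def real_root_pow_pos2)
  have "cmod c \<le> r" if c: "c \<in> essential_spectrum T" for c
  proof (rule ccontr)
    assume "\<not> cmod c \<le> r"
    then have "1/2 < cmod c ^ m" using r m(2) power_strict_mono[of r "cmod c" m] by simp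
    then have "calkin_invertible (\<lambda>x. T x - c *\<^sub>C x)"
      using T by (intro calkin_invertible_if_power_near_rank_one[OF T(1) character_bounded_clinear[OF h(1)]
            hT _ near]) (auto simp: unital_endomorphism_def)
    then show False using c by (simp add: essential_spectrum_def)
  qed
  then have "essential_spectral_radius T \<le> ennreal r"
    unfolding essential_spectral_radius_def using r(1) by (intro SUP_least ennreal_leI)
  also have "ennreal r < 1" using r by (simp add: ennreal_less_one_iff)
  finally show ?thesis using T(1) by (simp add: quasicompact_def)
qed


section \<open>Quasicompact endomorphisms\<close>

lemma unital_endomorphism_funpow:
  assumes "unital_endomorphism T"
  shows "unital_endomorphism (T ^^ n)"
  using assms by (induction n) (auto simp: unital_endomorphism_def clinear_iff)

context
  fixes T :: "'a::comm_complex_banach_algebra_1 \<Rightarrow> 'a"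
  assumes semiprime: "semiprime TYPE('a)"
    and connected: "connected_space (gelfand_topology :: ('a \<Rightarrow> complex) topology)"
    and T: "bounded_clinear T" "unital_endomorphism T"
    and proper: "\<And>z. cmod z \<le> 1 \<Longrightarrow> proper_on_bounded (\<lambda>x. x - z *\<^sub>C T x)"
begin

lemma endomorphism_mult: "T (a * b) = T a * T b" and endomorphism_one: "T 1 = 1"
  using T(2) by (auto simp: unital_endomorphism_def)

lemma endomorphism_power: "T (a ^ n) = T a ^ n"
  by (induction n) (simp_all add: endomorphism_mult endomorphism_one)

lemma endomorphism_scalar: "T (c *\<^sub>C 1) = c *\<^sub>C 1"
  by (simp add: bounded_clinear_scaleC[OF T(1)] endomorphism_one)

text \<open>The fixed points form a locally compact, hence finite-dimensional algebra, in which every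
  element is algebraic.\<close>

lemma fixed_point_scalar:
  assumes f: "T f = f"
  shows "\<exists>c. f = c *\<^sub>C 1"
proof -
  let ?W = "{x. T x = x}"
  have sub: "complex_vector.subspace ?W"
    by (rule complex_vector.subspaceI) (auto simp: bounded_clinear_simps[OF T(1)])
  have "locally_sequentially_compact ?W"
    unfolding locally_sequentially_compact_def
  proof (intro allI impI)
    fix x :: "nat \<Rightarrow> 'a"
    assume x: "(\<forall>n. x n \<in> ?W) \<and> bounded (range x)"
    then have "(\<lambda>n. x n - 1 *\<^sub>C T (x n)) \<longlonglongrightarrow> 0" by simp
    with x obtain r :: "nat \<Rightarrow> nat" and l where r: "strict_mono r" "(x \<circ> r) \<longlonglongrightarrow> l"
      using proper_on_boundedD[OF proper[of 1], of x 0] by auto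
    have "(\<lambda>n. T ((x \<circ> r) n)) \<longlonglongrightarrow> T l" by (rule bounded_clinear_tendsto[OF T(1) r(2)])
    moreover have "(\<lambda>n. T ((x \<circ> r) n)) = x \<circ> r" using x by (simp add: fun_eq_iff)
    ultimately have "T l = l" using r(2) LIMSEQ_unique by auto
    then show "\<exists>l\<in>?W. \<exists>r::nat \<Rightarrow> nat. strict_mono r \<and> (x \<circ> r) \<longlonglongrightarrow> l" using r by auto
  qed
  moreover have "f ^ n \<in> ?W" for n using f by (simp add: endomorphism_power)
  ultimately obtain n where "f ^ n \<in> complex_vector.span ((\<lambda>i. f ^ i) ` {..<n})"
    using locally_sequentially_compact_dependent[OF sub, of "\<lambda>i. f ^ i"] by auto
  then obtain p where "p \<noteq> 0" "eval_poly p f = 0" by (rule annihilating_poly_exists)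
  then show ?thesis by (rule algebraic_element_scalar[OF semiprime connected])
qed

text \<open>The character values \<open>h (T\<^sup>n f) = h f + n c\<close> are bounded by \<open>\<parallel>f\<parallel>\<close> because \<open>h \<circ> T\<^sup>n\<close> is a
  character.\<close>

lemma no_scalar_translation:
  assumes f: "T f = f + c *\<^sub>C 1"
  shows "c = 0"
proof (rule ccontr)
  assume "c \<noteq> 0"
  obtain h :: "'a \<Rightarrow> complex" where h: "h \<in> character_space" using character_exists by blast
  have iter: "(T ^^ n) f = f + (of_nat n * c) *\<^sub>C 1" for n
    by (induction n) (auto simp: bounded_clinear_add[OF T(1)] endomorphism_scalar f scaleC_add_left distrib_right)
  obtain n :: nat where n: "2 * norm f < real n * cmod c"
    using reals_Archimedean3[of "cmod c"] \<open>c \<noteq> 0\<close> by auto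
  have "h \<circ> (T ^^ n) \<in> character_space"
    using associated_selfmap_in_character_space[OF unital_endomorphism_funpow[OF T(2)] h]
    by (simp add: associated_selfmap_def)
  from character_norm_le[OF this, of f] have "cmod (h f + of_nat n * c) \<le> norm f"
    by (simp add: iter characterD[OF h])
  moreover have "cmod (h f) \<le> norm f" by (rule character_norm_le[OF h])
  moreover have "real n * cmod c \<le> cmod (h f + of_nat n * c) + cmod (h f)"
    using norm_triangle_ineq4[of "h f + of_nat n * c" "h f"] by (simp add: norm_mult)
  ultimately show False using n by linarith
qed

context
  fixes h :: "'a \<Rightarrow> complex"
  assumes h: "h \<in> character_space"
begin

text \<open>Subtracting \<open>h\<cdot>1\<close> sends the scalars, which are the fixed points of \<open>T\<close>, to \<open>0\<close>. This removes the
  eigenvalue \<open>1\<close> while other eigenvalues of modulus at least \<open>1\<close> would persist.\<close>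

definition deflated :: "'a \<Rightarrow> 'a" where
  "deflated x = T x - h x *\<^sub>C 1"

lemma deflated_bounded_clinear: "bounded_clinear deflated"
  unfolding deflated_def
  by (intro bounded_clinear_minus_op T(1) bounded_clinear_functional_scaleC character_bounded_clinear h)

lemma deflated_scalar: "deflated (c *\<^sub>C 1) = 0"
  by (simp add: deflated_def endomorphism_scalar characterD[OF h])

lemma deflated_fixed_point:
  assumes "deflated x = x"
  shows "x = 0"
proof -
  have x: "T x = x + h x *\<^sub>C 1" using assms by (simp add: deflated_def algebra_simps)
  then have hx: "h x = 0" by (rule no_scalar_translation)
  then have "T x = x" using x by simp
  then obtain c where c: "x = c *\<^sub>C 1" using fixed_point_scalar by blast
  then have "c = 0" using hx by (simp add: characterD[OF h])
  then show ?thesis using c by simp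
qed

lemma deflated_proper:
  assumes "cmod z \<le> 1"
  shows "proper_on_bounded (\<lambda>x. x - z *\<^sub>C deflated x)"
proof -
  have "proper_on_bounded (\<lambda>x. (x - z *\<^sub>C T x) + h x *\<^sub>C (z *\<^sub>C 1))"
    by (rule proper_on_bounded_rank_one_perturbation[OF proper[OF assms] character_bounded_clinear[OF h]])
  moreover have "(x - z *\<^sub>C T x) + h x *\<^sub>C (z *\<^sub>C 1) = x - z *\<^sub>C deflated x" for x
    by (simp add: deflated_def scaleC_diff_right mult.commute)
  ultimately show ?thesis by (simp only:)
qed

text \<open>An eigenvector \<open>f\<close> of \<open>T\<close> for \<open>c \<noteq> 1\<close> yields the eigenvector \<open>f - h(f)/c\<close> of the deflated
  operator, for which \<open>1\<close> is at a positive distance from the eigenvalues.\<close>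

lemma eigenvalue_gap:
  obtains d where "d > 0"
    "\<And>c f. cmod c = 1 \<Longrightarrow> c \<noteq> 1 \<Longrightarrow> f \<noteq> 0 \<Longrightarrow> T f = c *\<^sub>C f \<Longrightarrow> d \<le> cmod (c - 1)"
proof -
  have inj1: "z \<in> {1} \<Longrightarrow> x = z *\<^sub>C deflated x \<Longrightarrow> x = 0" for z x
    using deflated_fixed_point by auto
  have proper1: "z \<in> {1} \<Longrightarrow> proper_on_bounded (\<lambda>x. x - z *\<^sub>C deflated x)" for z
    by (rule deflated_proper) simp
  obtain d where d: "d > 0" "\<And>z x. z \<in> {1} \<Longrightarrow> d * norm x \<le> norm (x - z *\<^sub>C deflated x)"
    by (rule uniformly_bounded_below[OF deflated_bounded_clinear _ proper1 inj1, of "{1}"]) auto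
  have "d \<le> cmod (c - 1)" if c: "cmod c = 1" "c \<noteq> 1" and f: "f \<noteq> 0" "T f = c *\<^sub>C f" for c f
  proof -
    have c0: "c \<noteq> 0" using c by auto
    define g where "g = f - (h f / c) *\<^sub>C 1"
    have "g \<noteq> 0"
    proof
      assume "g = 0"
      then have "f = (h f / c) *\<^sub>C 1" by (simp add: g_def)
      then have "T f = f" using endomorphism_scalar by metis
      then have "(c - 1) *\<^sub>C f = 0" using f(2) by (simp add: scaleC_diff_left)
      then show False using c(2) f(1) by (metis complex_vector.scale_eq_0_iff right_minus_eq)
    qed
    have "deflated g = T f - h f *\<^sub>C 1"
      by (simp only: g_def bounded_clinear_diff[OF deflated_bounded_clinear] deflated_scalar)
         (simp add: deflated_def)
    also have "\<dots> = c *\<^sub>C g" using c0 by (simp add: g_def f(2) scaleC_diff_right)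
    finally have "g - 1 *\<^sub>C deflated g = (1 - c) *\<^sub>C g" by (simp add: scaleC_diff_left)
    then have "d * norm g \<le> cmod (c - 1) * norm g"
      using d(2)[of 1 g] by (simp only: norm_scaleC norm_minus_commute singletonI)
    then show ?thesis using \<open>g \<noteq> 0\<close> by simp
  qed
  then show ?thesis using that d(1) by blast
qed

text \<open>Powers of an eigenvector \<open>f\<close> are eigenvectors for the powers of its eigenvalue \<open>c\<close>, and they do
  not vanish. So \<open>|c| > 1\<close> contradicts boundedness of \<open>T\<close>. If \<open>|c| = 1\<close>, then some power of \<open>c\<close> falls
  into the gap around \<open>1\<close> and thus equals \<open>1\<close>. The same power of \<open>f\<close> is a fixed point, hence a
  scalar, so \<open>f\<close> is algebraic and itself a scalar.\<close>

lemma peripheral_eigenvalue: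
  assumes f: "T f = c *\<^sub>C f" "f \<noteq> 0" and c: "cmod c \<ge> 1"
  shows "c = 1"
proof -
  have pow: "T (f ^ n) = c ^ n *\<^sub>C f ^ n" for n
    unfolding endomorphism_power f(1)
    by (induction n) (auto simp: scaleC_mult_left scaleC_mult_right mult_ac)
  have nz: "f ^ n \<noteq> 0" for n using f(2) semiprime_power_eq_0[OF semiprime] by blast
  have "cmod c = 1"
  proof (rule ccontr)
    assume "cmod c \<noteq> 1"
    then have c1: "cmod c > 1" using c by simp
    obtain K where K: "K > 0" "\<And>x. norm (T x) \<le> K * norm x" using bounded_clinear_bound[OF T(1)] by blast
    obtain n where n: "K < cmod c ^ n" using real_arch_pow[OF c1] by blast
    have "cmod c ^ n * norm (f ^ n) \<le> K * norm (f ^ n)"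
      using K(2)[of "f ^ n"] by (simp only: pow norm_scaleC norm_power)
    then show False using n nz[of n] by simp
  qed
  obtain d where d: "d > 0"
    "\<And>c f. cmod c = 1 \<Longrightarrow> c \<noteq> 1 \<Longrightarrow> f \<noteq> 0 \<Longrightarrow> T f = c *\<^sub>C f \<Longrightarrow> d \<le> cmod (c - 1)"
    by (rule eigenvalue_gap) blast
  have "\<exists>n>0. cmod (c ^ n - 1) < d"
  proof -
    have "bounded (range (\<lambda>n. c ^ n))"
      using \<open>cmod c = 1\<close> by (auto simp: bounded_iff norm_power)
    then obtain l and r :: "nat \<Rightarrow> nat" where r: "strict_mono r" "((\<lambda>n. c ^ n) \<circ> r) \<longlonglongrightarrow> l"
      using bounded_imp_convergent_subsequence by blast
    from LIMSEQ_imp_Cauchy[OF r(2)] obtain N where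
      N: "\<And>m n. m \<ge> N \<Longrightarrow> n \<ge> N \<Longrightarrow> cmod (((\<lambda>n. c ^ n) \<circ> r) m - ((\<lambda>n. c ^ n) \<circ> r) n) < d"
      using CauchyD d(1) by blast
    have lt: "r N < r (Suc N)" using r(1) by (simp add: strict_mono_def)
    define k where "k = r (Suc N) - r N"
    have "c ^ r (Suc N) - c ^ r N = c ^ r N * (c ^ k - 1)"
      using lt by (simp add: k_def right_diff_distrib power_add[symmetric])
    then have "cmod (c ^ r (Suc N) - c ^ r N) = cmod (c ^ k - 1)"
      by (simp add: norm_mult norm_power \<open>cmod c = 1\<close>)
    then show ?thesis using N[of "Suc N" N] lt by (intro exI[of _ k]) (simp add: k_def)
  qed
  then obtain n where n: "n > 0" "cmod (c ^ n - 1) < d" by blast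
  have "c ^ n = 1"
  proof (rule ccontr)
    assume "c ^ n \<noteq> 1"
    then have "d \<le> cmod (c ^ n - 1)"
      using \<open>cmod c = 1\<close> by (intro d(2)[of _ "f ^ n"] pow nz) (simp_all add: norm_power)
    then show False using n(2) by simp
  qed
  then have "T (f ^ n) = f ^ n" using pow[of n] by simp
  then obtain a where a: "f ^ n = a *\<^sub>C 1" using fixed_point_scalar by blast
  define p where "p = monom 1 n + smult (- a) 1"
  have "coeff p n = 1" using n(1) by (cases n) (simp_all add: p_def)
  then have "p \<noteq> 0" by auto
  moreover have "eval_poly p f = 0"
  proof -
    have "eval_poly 1 f = 1" by (simp add: eval_poly_def)
    then show ?thesis unfolding p_def eval_poly_add eval_poly_smult eval_poly_monom
      by (simp add: a scaleC_minus_left)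
  qed
  ultimately obtain b where "f = b *\<^sub>C 1"
    using algebraic_element_scalar[OF semiprime connected] by blast
  then have "T f = f" using endomorphism_scalar by metis
  then have "(c - 1) *\<^sub>C f = 0" using f(1) by (simp add: scaleC_diff_left)
  then show ?thesis using f(2) by (metis complex_vector.scale_eq_0_iff right_minus_eq)
qed

lemma deflated_no_peripheral_eigenvalue:
  assumes z: "cmod z \<le> 1" and x: "x = z *\<^sub>C deflated x"
  shows "x = 0"
proof (cases "z = 0")
  case True
  then show ?thesis using x by simp
next
  case False
  define c where "c = inverse z"
  have c: "cmod c \<ge> 1" using z False by (simp add: c_def norm_inverse one_le_inverse_iff)
  have "c *\<^sub>C x = deflated x" using arg_cong[OF x, of "\<lambda>y. c *\<^sub>C y"] False by (simp add: c_def)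
  then have Tx: "T x = c *\<^sub>C x + h x *\<^sub>C 1" by (simp add: deflated_def algebra_simps)
  show ?thesis
  proof (cases "c = 1")
    case True
    then show ?thesis using \<open>c *\<^sub>C x = deflated x\<close> by (intro deflated_fixed_point) simp
  next
    case c1: False
    \<comment> \<open>A scalar shift removes the term \<open>h(x)\<close> and turns \<open>x\<close> into an eigenvector of \<open>T\<close>.\<close>
    let ?a = "h x / (c - 1)"
    define y where "y = x + ?a *\<^sub>C 1"
    have "h x + ?a = c * ?a" using c1 by (simp add: field_simps)
    then have "h x *\<^sub>C 1 + ?a *\<^sub>C (1::'a) = (c * ?a) *\<^sub>C 1" by (simp only: scaleC_add_left[symmetric])
    then have "T y = c *\<^sub>C y"
      by (simp only: y_def bounded_clinear_add[OF T(1)] endomorphism_scalar Tx scaleC_add_right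
          scaleC_scaleC add.assoc)
    then have "y = 0" using peripheral_eigenvalue[of y c] c c1 by blast
    then have "h x + ?a = 0" using characterD[OF h] unfolding y_def by (metis mult.right_neutral)
    then have "h x = 0" using c1 c by (auto simp: field_simps)
    then show ?thesis using \<open>y = 0\<close> by (simp add: y_def)
  qed
qed

text \<open>With \<open>D\<close> the deflated operator and \<open>W = (1 - D)\<^sup>-\<^sup>1\<close>, iterating \<open>T = D + h\<cdot>1\<close> gives
  \<open>T\<^sup>n = D\<^sup>n + h(1 + D + \<dots> + D\<^sup>n\<^sup>-\<^sup>1)\<cdot>1\<close>, and the geometric sum is \<open>W - D\<^sup>n W\<close>.\<close>

lemma powers_converge_to_rank_one:
  "\<exists>P. rank_one P \<and> unital_endomorphism P \<and> converges_in_operator_norm (\<lambda>n. T ^^ n) P"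
proof -
  let ?D = deflated
  note D = deflated_bounded_clinear
  obtain d where d: "d > 0" "\<And>z x. z \<in> cball 0 1 \<Longrightarrow> d * norm x \<le> norm (x - z *\<^sub>C ?D x)"
    using uniformly_bounded_below[OF D compact_cball[of 0 1]] deflated_proper
      deflated_no_peripheral_eigenvalue by (auto simp: dist_norm)
  then have below: "cmod z \<le> 1 \<Longrightarrow> d * norm x \<le> norm (x - z *\<^sub>C ?D x)" for z x by simp
  note small = powers_tend_to_zero[OF D d(1) below]
  define W where "W = disc_resolvent ?D 1"
  have W: "bounded_clinear W" "W x - ?D (W x) = x" for x
    using disc_resolvent(1,2)[OF D d(1) below, of 1] by (simp_all add: W_def)
  note hlin = character_bounded_clinear[OF h]
  note Dn = bounded_clinear_funpow[OF D]
  obtain M where M: "M > 0" "\<And>x. norm (W x) \<le> M * norm x" using bounded_clinear_bound[OF W(1)] by blast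
  define P where "P = (\<lambda>x. h (W x) *\<^sub>C (1::'a))"
  have linhW: "bounded_clinear (\<lambda>x. h (W x))" by (rule bounded_clinear_compose[OF hlin W(1)])
  have linP: "bounded_clinear P" unfolding P_def by (rule bounded_clinear_functional_scaleC[OF linhW])
  have diff: "(T ^^ n) x - P x = (?D ^^ n) x - h ((?D ^^ n) (W x)) *\<^sub>C 1" for n x
  proof (induction n)
    case 0
    show ?case by (simp add: P_def)
  next
    case (Suc n)
    have "(T ^^ n) x = P x + ((?D ^^ n) x - h ((?D ^^ n) (W x)) *\<^sub>C 1)"
      using Suc by (simp add: algebra_simps)
    then have "(T ^^ Suc n) x = P x + (T ((?D ^^ n) x) - h ((?D ^^ n) (W x)) *\<^sub>C 1)"
      by (simp add: P_def bounded_clinear_add[OF T(1)] bounded_clinear_diff[OF T(1)] endomorphism_scalar)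
    moreover have "T ((?D ^^ n) x) = (?D ^^ Suc n) x + h ((?D ^^ n) x) *\<^sub>C 1"
      by (simp add: deflated_def)
    moreover have "h ((?D ^^ n) x) = h ((?D ^^ n) (W x)) - h ((?D ^^ Suc n) (W x))"
    proof -
      have "(?D ^^ n) x = (?D ^^ n) (W x - ?D (W x))" by (simp only: W(2))
      also have "\<dots> = (?D ^^ n) (W x) - (?D ^^ Suc n) (W x)"
        by (simp add: bounded_clinear_diff[OF Dn] funpow_swap1)
      finally show ?thesis by (simp only: characterD[OF h])
    qed
    ultimately show ?case by (simp add: scaleC_diff_left)
  qed
  have conv: "converges_in_operator_norm (\<lambda>n. T ^^ n) P"
    unfolding converges_in_operator_norm_def
  proof (intro conjI allI linP bounded_clinear_funpow T(1))
    have lin: "bounded_clinear (\<lambda>x. (T ^^ n) x - P x)" for n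
      by (intro bounded_clinear_minus_op bounded_clinear_funpow T(1) linP)
    show "(\<lambda>n. onorm (\<lambda>x. (T ^^ n) x - P x)) \<longlonglongrightarrow> 0"
    proof (rule LIMSEQ_I)
      fix e :: real assume e: "e > 0"
      define k where "k = 1 + M * norm (1::'a)"
      have k: "k > 0" using M(1) by (simp add: k_def add_pos_nonneg)
      have "\<forall>\<^sub>F n in sequentially. \<forall>x. norm ((?D ^^ n) x) \<le> e / (2 * k) * norm x"
        using e k by (intro small) auto
      then obtain N where N: "\<And>n x. n \<ge> N \<Longrightarrow> norm ((?D ^^ n) x) \<le> e / (2 * k) * norm x"
        by (auto simp: eventually_sequentially)
      have "norm (onorm (\<lambda>x. (T ^^ n) x - P x) - 0) < e" if n: "n \<ge> N" for n
      proof -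
        have "norm ((T ^^ n) x - P x) \<le> e / 2 * norm x" for x
        proof -
          have "norm ((T ^^ n) x - P x) \<le> norm ((?D ^^ n) x) + cmod (h ((?D ^^ n) (W x))) * norm (1::'a)"
            unfolding diff using norm_triangle_ineq4 by (metis norm_scaleC)
          also have "cmod (h ((?D ^^ n) (W x))) \<le> e / (2 * k) * (M * norm x)"
          proof -
            have "cmod (h ((?D ^^ n) (W x))) \<le> norm ((?D ^^ n) (W x))" by (rule character_norm_le[OF h])
            also have "\<dots> \<le> e / (2 * k) * norm (W x)" by (rule N[OF n])
            also have "\<dots> \<le> e / (2 * k) * (M * norm x)"
              using e k by (intro mult_left_mono M(2)) auto
            finally show ?thesis .
          qed
          then have "norm ((?D ^^ n) x) + cmod (h ((?D ^^ n) (W x))) * norm (1::'a) \<le>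
              e / (2 * k) * norm x + e / (2 * k) * (M * norm x) * norm (1::'a)"
            by (intro add_mono N[OF n] mult_right_mono) auto
          also have "\<dots> = e / (2 * k) * (1 + M * norm (1::'a)) * norm x"
            by (simp only: distrib_left distrib_right mult_1_right mult_ac)
          also have "\<dots> = e / (2 * k) * k * norm x" by (simp only: k_def)
          also have "\<dots> = e / 2 * norm x" using k by simp
          finally show ?thesis .
        qed
        then have "onorm (\<lambda>x. (T ^^ n) x - P x) \<le> e / 2" using e by (intro onorm_bound) auto
        moreover have "0 \<le> onorm (\<lambda>x. (T ^^ n) x - P x)"
          by (rule onorm_pos_le[OF bounded_clinear_linear[OF lin]])
        ultimately show ?thesis using e by simp
      qed
      then show "\<exists>N. \<forall>n\<ge>N. norm (onorm (\<lambda>x. (T ^^ n) x - P x) - 0) < e" by blast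
    qed
  qed
  note lim = converges_in_operator_norm_pointwise[OF conv]
  have endo: "unital_endomorphism P"
    unfolding unital_endomorphism_def
  proof (intro conjI allI)
    show "clinear P" using linP by (simp add: bounded_clinear_def)
    show "P (a * b) = P a * P b" for a b
    proof (rule LIMSEQ_unique[OF lim])
      have "(T ^^ n) (a * b) = (T ^^ n) a * (T ^^ n) b" for n
        using unital_endomorphism_funpow[OF T(2)] by (simp add: unital_endomorphism_def)
      then show "(\<lambda>n. (T ^^ n) (a * b)) \<longlonglongrightarrow> P a * P b" by (simp add: tendsto_mult lim)
    qed
    show "P 1 = 1"
    proof (rule LIMSEQ_unique[OF lim])
      have "(T ^^ n) 1 = 1" for n
        using unital_endomorphism_funpow[OF T(2)] by (simp add: unital_endomorphism_def)
      then show "(\<lambda>n. (T ^^ n) 1) \<longlonglongrightarrow> 1" by simp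
    qed
  qed
  have "h (W 1) *\<^sub>C (1::'a) = 1"
    using endo by (simp add: unital_endomorphism_def P_def)
  then have "h (W 1) *\<^sub>C (1::'a) = 1 *\<^sub>C 1" by (simp only: scaleC_one)
  then have "h (W 1) = 1" by (simp only: scaleC_one_inject)
  moreover have "h (W (c *\<^sub>C 1)) = c * h (W 1)" for c
    by (simp add: bounded_clinear_scaleC[OF W(1)] characterD[OF h])
  ultimately have "rank_one P" unfolding P_def
    by (intro rank_one_functional_scaleC[where h = "\<lambda>x. h (W x)" and x = 1]) auto
  then show ?thesis using endo conv by blast
qed

end

end

theorem theorem2p2:
  fixes T :: "'a::comm_complex_banach_algebra_1 \<Rightarrow> 'a"
    and \<phi> :: "('a \<Rightarrow> complex) \<Rightarrow> ('a \<Rightarrow> complex)"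
  assumes "semiprime TYPE('a)"
    and "connected_space (gelfand_topology :: ('a \<Rightarrow> complex) topology)"
    and "bounded_clinear T"
    and "unital_endomorphism T"
  defines "\<phi> \<equiv> associated_selfmap T"
  shows "(quasicompact T \<longleftrightarrow>
            (\<exists>P. rank_one P \<and> unital_endomorphism P \<and> converges_in_operator_norm (\<lambda>n. T ^^ n) P))
       \<and> (quasicompact T \<longrightarrow>
            (\<exists>x0\<in>character_space. (\<forall>x\<in>character_space. \<phi> x = x \<longleftrightarrow> x = x0) \<and>
               (\<forall>P. rank_one P \<and> unital_endomorphism P \<and> converges_in_operator_norm (\<lambda>n. T ^^ n) P
                  \<longrightarrow> P = (\<lambda>b. gelfand_transform b x0 *\<^sub>C 1))))"
proof -
  let ?lim = "\<lambda>P. rank_one P \<and> unital_endomorphism P \<and> converges_in_operator_norm (\<lambda>n. T ^^ n) P"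
  have forward: "\<exists>P. ?lim P" if "quasicompact T"
  proof -
    obtain h :: "'a \<Rightarrow> complex" where "h \<in> character_space" using character_exists by blast
    then show ?thesis
      using powers_converge_to_rank_one[OF assms(1-4) quasicompact_proper[OF that]] by blast
  qed
  moreover have "quasicompact T" if "?lim P" for P
    using quasicompact_if_powers_converge[OF assms(3,4)] that by blast
  moreover have "\<exists>x0\<in>character_space. (\<forall>x\<in>character_space. \<phi> x = x \<longleftrightarrow> x = x0) \<and>
      (\<forall>P. ?lim P \<longrightarrow> P = (\<lambda>b. gelfand_transform b x0 *\<^sub>C 1))" if qc: "quasicompact T"
  proof -
    obtain P where P: "rank_one P" "unital_endomorphism P" "converges_in_operator_norm (\<lambda>n. T ^^ n) P"
      using forward[OF qc] by blast
    obtain x0 where x0: "x0 \<in> character_space" "P = (\<lambda>b. x0 b *\<^sub>C 1)"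
      by (rule rank_one_unital_endomorphism[OF P(1,2)])
    note lim = converges_in_operator_norm_pointwise[OF P(3)]
    have "x \<circ> T = x \<longleftrightarrow> x = x0" if x: "x \<in> character_space" for x
    proof
      assume fix_x: "x \<circ> T = x"
      \<comment> \<open>Continuity of \<open>x\<close> carries the invariance over to the limit: \<open>x = x \<circ> P\<close>.\<close>
      have inv: "x ((T ^^ n) b) = x b" for n b
      proof (induction n)
        case (Suc n)
        then show ?case using fun_cong[OF fix_x, of "(T ^^ n) b"] by simp
      qed simp
      show "x = x0"
      proof
        fix b
        have "(\<lambda>n. x ((T ^^ n) b)) \<longlonglongrightarrow> x (P b)"
          by (rule bounded_clinear_tendsto[OF character_bounded_clinear[OF x] lim])
        then have "x b = x (P b)" by (simp add: inv LIMSEQ_const_iff)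
        then show "x b = x0 b" by (simp add: x0(2) characterD[OF x])
      qed
    next
      assume "x = x0"
      have "P (T b) = P b" for b
      proof (rule LIMSEQ_unique[OF lim])
        show "(\<lambda>n. (T ^^ n) (T b)) \<longlonglongrightarrow> P b"
          using LIMSEQ_Suc[OF lim[of b]] by (simp add: funpow_swap1)
      qed
      then have "x0 (T b) = x0 b" for b unfolding x0(2) by (simp add: scaleC_one_inject)
      then show "x \<circ> T = x" using \<open>x = x0\<close> by (simp add: fun_eq_iff)
    qed
    moreover have "Q = (\<lambda>b. gelfand_transform b x0 *\<^sub>C 1)" if "?lim Q" for Q
    proof
      fix b
      have "Q b = P b"
        using that converges_in_operator_norm_pointwise[of "\<lambda>n. T ^^ n" Q b] lim[of b] LIMSEQ_unique by blast
      then show "Q b = gelfand_transform b x0 *\<^sub>C 1" by (simp add: x0(2) gelfand_transform_def)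
    qed
    ultimately show ?thesis
      using x0(1) by (intro bexI[of _ x0]) (auto simp: \<phi>_def associated_selfmap_def)
  qed
  ultimately show ?thesis by blast
qed

end
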